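(* Let $\boldsymbol\lambda=(\boldsymbol\lambda_1\ge\dots\ge\boldsymbol\lambda_n)$ be a Young diagram with $\boldsymbol\lambda_n=0$ and $\boldsymbol\mu=(\boldsymbol\mu_1\ge\dots\ge\boldsymbol\mu_n)$ a weakly decreasing sequence of integers with $\boldsymbol\mu_n=-1$ and $|\boldsymbol\lambda|+|\boldsymbol\mu|=0$. Let $x_1,\dots,x_{\boldsymbol\lambda_1}\in\mathbb{C}$ and $D=\sum_{k=1}^{\boldsymbol\lambda_1}\varpi_{n-\boldsymbol\lambda^t_k}[x_k]+\mu[\infty]$, where $\boldsymbol\lambda^t_k$ is the height of the $k$-th column of $\boldsymbol\lambda$ and $\mu=-\sum_{i=1}^n\boldsymbol\mu_{n-i+1}\epsilon_i$. Put $m:=\max\{i:\boldsymbol\mu_{n-i+1}=-1\}$ and $m':=\max\{i:\boldsymbol\mu_{n-i+1}\le0\}$. Then: (a) The entries of $T_D(z)$ (for this $D$, $Z_0=1$) are: on the diagonal, $T_D(z)_{ii}=z+\sum_{r=1}^{a_{i-1}}(p_{i-1,r}+1)-\sum_{r=1}^{a_i}p_{i,r}+\sum_{x\in\mathbb{C}}\epsilon^\vee_i(\lambda_x)x$ if $i\le m$, $T_D(z)_{ii}=1$ if $m<i\le m'$, and $T_D(z)_{ii}=0$ if $i>m'$; for $m<i<j$, $T_D(z)_{ij}=0=T_D(z)_{ji}$; for $i\le m$ and $i<j$, $$T_D(z)_{ij}=-\sum_{r_i,\dots,r_{j-1}}\frac{P_{i-1}(p_{i,r_i}-1)\prod_{k=i}^{j-2}P_{k,r_k}(p_{k+1,r_{k+1}}-1)}{\prod_{k=i}^{j-1}P_{k,r_k}(p_{k,r_k})}\prod_{k=i}^{j-1}Z_k(p_{k,r_k})\,e^{\sum_{k=i}^{j-1}q_{k,r_k}},$$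 $$T_D(z)_{ji}=\sum_{r_i,\dots,r_{j-1}}\frac{P_j(p_{j-1,r_{j-1}}+1)\prod_{k=i+1}^{j-1}P_{k,r_k}(p_{k-1,r_{k-1}}+1)}{\prod_{k=i}^{j-1}P_{k,r_k}(p_{k,r_k})}\,e^{-\sum_{k=i}^{j-1}q_{k,r_k}}$$ (sums over $1\le r_k\le a_k$). (b) $T_D(z)$ is a polynomial of degree $1$ in $z$ whose coefficient of $z$ is $\sum_{i=1}^mE_{ii}$.
   Context: Let $n\ge2$, $\Lambda=\bigoplus_{j=1}^n\mathbb{Z}\epsilon_j$, $\epsilon^\vee_j$ dual basis, $\alpha_i=\epsilon_i-\epsilon_{i+1}$, $\varpi_i=-\sum_{j=i+1}^n\epsilon_j$ ($0\le i\le n-1$). For the divisor $D$ of the claim write it as $\sum_{s=1}^N\gamma_s\varpi_{i_s}[x_s]+\mu[\infty]$ with $N=\boldsymbol\lambda_1$, $i_s=n-\boldsymbol\lambda^t_s$, $\gamma_s=1$; put $\lambda=\sum_s\varpi_{i_s}$, $\lambda_x=\sum_{s:x_s=x}\varpi_{i_s}$. Then $\lambda+\mu=\sum_{i=1}^{n-1}a_i\alpha_i$ with $a_i=-\sum_{j=n-i+1}^n(\boldsymbol\lambda_j+\boldsymbol\mu_j)\in\mathbb{Z}_{\ge0}$; $a_0=a_n=0$. $\mathcal{A}$: the $\mathbb{C}$-algebra generated by $p_{i,r},e^{\pm q_{i,r}},(p_{i,r}-p_{i,s}+m)^{-1}$ ($1\le i<n$, $1\le r\ne s\le a_i$, $m\in\mathbb{Z}$)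 with $[e^{\pm q_{i,r}},p_{j,s}]=\mp\delta_{ij}\delta_{rs}e^{\pm q_{i,r}}$, $p$'s commuting, $e^q$'s commuting, $e^{\pm q_{i,r}}e^{\mp q_{i,r}}=1$. $Z_i(z)=\prod_{s:i_s=i}(z-x_s)^{\gamma_s}$, $P_j(z)=\prod_{r=1}^{a_j}(z-p_{j,r})$, $P_{j,r}(z)=\prod_{s\ne r}(z-p_{j,s})$, $P_0=P_n=1$. $T_D(z)\in\mathcal{A}((z^{-1}))\otimes\mathrm{End}\,\mathbb{C}^n$: $T_D(z)_{\alpha\beta}=\sum_{i=1}^{\min(\alpha,\beta)}f^D_{\alpha i}(z)g^D_i(z)e^D_{i\beta}(z)$, where (expanded in $z^{-1}$) $g^D_i(z)=\frac{P_i(z)}{P_{i-1}(z-1)}\prod_{k=0}^{i-1}Z_k(z)$, $e^D_{ii}=f^D_{ii}=1$ and for $i<j$: $e^D_{ij}(z)=-\sum_{r_i,\dots,r_{j-1}}\frac{P_{i-1}(p_{i,r_i}-1)\prod_{k=i}^{j-2}P_{k,r_k}(p_{k+1,r_{k+1}}-1)}{(z-p_{i,r_i})\prod_{k=i}^{j-1}P_{k,r_k}(p_{k,r_k})}\prod_{k=i}^{j-1}Z_k(p_{k,r_k})\, e^{\sum_{k=i}^{j-1}q_{k,r_k}}$, $f^D_{ji}(z)=\sum_{r_i,\dots,r_{j-1}}\frac{P_j(p_{j-1,r_{j-1}}+1)\prod_{k=i+1}^{j-1}P_{k,r_k}(p_{k-1,r_{k-1}}+1)}{(z-p_{i,r_i}-1)\prod_{k=i}^{j-1}P_{k,r_k}(p_{k,r_k})}\,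 e^{-\sum_{k=i}^{j-1}q_{k,r_k}}$. *)

theory Defs
  imports Complex_Main "HOL-Computational_Algebra.Formal_Laurent_Series"
begin

definition colh :: "nat \<Rightarrow> (nat \<Rightarrow> nat) \<Rightarrow> nat \<Rightarrow> nat" where
  "colh n lam s = card {j \<in> {1..n}. s \<le> lam j}"

definition iS :: "nat \<Rightarrow> (nat \<Rightarrow> nat) \<Rightarrow> nat \<Rightarrow> nat" where
  "iS n lam s = n - colh n lam s"

definition avec :: "nat \<Rightarrow> (nat \<Rightarrow> nat) \<Rightarrow> (nat \<Rightarrow> int) \<Rightarrow> nat \<Rightarrow> nat" where
  "avec n lam mu i = (if 1 \<le> i \<and> i < n
      then nat (- (\<Sum>j\<in>{n-i+1..n}. int (lam j) + mu j)) else 0)"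

(* varpi_i = - sum_{j=i+1}^n eps_j, as its coefficient function j \<mapsto> eps_j^vee(varpi_i) *)
definition varpi :: "nat \<Rightarrow> nat \<Rightarrow> nat \<Rightarrow> int" where
  "varpi n i j = (if i < j \<and> j \<le> n then -1 else 0)"

definition lamx :: "nat \<Rightarrow> (nat \<Rightarrow> nat) \<Rightarrow> (nat \<Rightarrow> complex) \<Rightarrow> complex \<Rightarrow> nat \<Rightarrow> int" where
  "lamx n lam x y j = (\<Sum>s\<in>{s\<in>{1..lam 1}. x s = y}. varpi n (iS n lam s) j)"

definition ainv :: "'a::monoid_mult \<Rightarrow> 'a" where
  "ainv u = (THE v. u * v = 1 \<and> v * u = 1)"

text \<open>The defining relations of the algebra A, realised in an arbitrary ring 'b with a central
  copy of the complex numbers (emb).  p i r = p_{i,r}, eq i r = e^{q_{i,r}}, eqi i r = e^{-q_{i,r}}.\<close>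
definition A_rel :: "nat \<Rightarrow> (nat \<Rightarrow> nat) \<Rightarrow> (complex \<Rightarrow> 'b::ring_1) \<Rightarrow> (nat \<Rightarrow> nat \<Rightarrow> 'b)
    \<Rightarrow> (nat \<Rightarrow> nat \<Rightarrow> 'b) \<Rightarrow> (nat \<Rightarrow> nat \<Rightarrow> 'b) \<Rightarrow> bool" where
  "A_rel n a emb p eq eqi \<longleftrightarrow>
     emb 1 = 1 \<and> (\<forall>c d. emb (c + d) = emb c + emb d) \<and> (\<forall>c d. emb (c * d) = emb c * emb d)
   \<and> (\<forall>c y. emb c * y = y * emb c)
   \<and> (\<forall>i r j s. i \<in> {1..<n} \<and> r \<in> {1..a i} \<and> j \<in> {1..<n} \<and> s \<in> {1..a j} \<longrightarrow>
        p i r * p j s = p j s * p i r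
      \<and> eq i r * eq j s = eq j s * eq i r
      \<and> eq i r * eqi j s = eqi j s * eq i r
      \<and> eqi i r * eqi j s = eqi j s * eqi i r
      \<and> eq i r * p j s - p j s * eq i r = (if i = j \<and> r = s then - eq i r else 0)
      \<and> eqi i r * p j s - p j s * eqi i r = (if i = j \<and> r = s then eqi i r else 0))
   \<and> (\<forall>i r. i \<in> {1..<n} \<and> r \<in> {1..a i} \<longrightarrow> eq i r * eqi i r = 1 \<and> eqi i r * eq i r = 1)
   \<and> (\<forall>i r s (m::int). i \<in> {1..<n} \<and> r \<in> {1..a i} \<and> s \<in> {1..a i} \<and> r \<noteq> s \<longrightarrow>
        (\<exists>v. v * (p i r - p i s + of_int m) = 1 \<and> (p i r - p i s + of_int m) * v = 1))"

text \<open>Polynomials P_j, P_{j,r}, Z_k evaluated at an element c of a ring (products of commuting factors).\<close>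
definition Pev :: "(nat \<Rightarrow> nat \<Rightarrow> 'b::ring_1) \<Rightarrow> (nat \<Rightarrow> nat) \<Rightarrow> nat \<Rightarrow> 'b \<Rightarrow> 'b" where
  "Pev p a j c = prod_list (map (\<lambda>r. c - p j r) [1..<Suc (a j)])"

definition Pexc :: "(nat \<Rightarrow> nat \<Rightarrow> 'b::ring_1) \<Rightarrow> (nat \<Rightarrow> nat) \<Rightarrow> nat \<Rightarrow> nat \<Rightarrow> 'b \<Rightarrow> 'b" where
  "Pexc p a j r c = prod_list (map (\<lambda>s. c - p j s) (filter (\<lambda>s. s \<noteq> r) [1..<Suc (a j)]))"

definition Zev :: "nat \<Rightarrow> (nat \<Rightarrow> nat) \<Rightarrow> (nat \<Rightarrow> complex) \<Rightarrow> (complex \<Rightarrow> 'b::ring_1) \<Rightarrow> nat \<Rightarrow> 'b \<Rightarrow> 'b" where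
  "Zev n lam x emb k c =
     prod_list (map (\<lambda>s. c - emb (x s)) (filter (\<lambda>s. iS n lam s = k) [1..<Suc (lam 1)]))"

text \<open>Laurent series in z^{-1}: the type 'b fls in the variable w = z^{-1} (fls_X),
  so z = fls_X_inv; zres c is the expansion of (z - c)^{-1} = sum_k c^k z^{-k-1}.\<close>
definition zvar :: "'b::ring_1 fls" where "zvar = fls_X_inv"

definition zres :: "'b::ring_1 \<Rightarrow> 'b fls" where
  "zres c = fls_X * fps_to_fls (Abs_fps (\<lambda>k. c ^ k))"

definition gD :: "nat \<Rightarrow> (nat \<Rightarrow> nat) \<Rightarrow> (nat \<Rightarrow> complex) \<Rightarrow> (complex \<Rightarrow> 'b::ring_1)
    \<Rightarrow> (nat \<Rightarrow> nat \<Rightarrow> 'b) \<Rightarrow> (nat \<Rightarrow> nat) \<Rightarrow> nat \<Rightarrow> 'b fls" where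
  "gD n lam x emb p a i =
     Pev (\<lambda>j r. fls_const (p j r)) a i zvar
   * prod_list (map (\<lambda>r. zres (p (i-1) r + 1)) [1..<Suc (a (i-1))])
   * prod_list (map (\<lambda>k. Zev n lam x (\<lambda>c. fls_const (emb c)) k zvar) [0..<i])"

definition ecoef :: "nat \<Rightarrow> (nat \<Rightarrow> nat) \<Rightarrow> (nat \<Rightarrow> complex) \<Rightarrow> (complex \<Rightarrow> 'b::ring_1)
    \<Rightarrow> (nat \<Rightarrow> nat \<Rightarrow> 'b) \<Rightarrow> (nat \<Rightarrow> nat \<Rightarrow> 'b) \<Rightarrow> (nat \<Rightarrow> nat) \<Rightarrow> nat \<Rightarrow> nat \<Rightarrow> (nat \<Rightarrow> nat) \<Rightarrow> 'b" where
  "ecoef n lam x emb p eq a i j r =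
     Pev p a (i-1) (p i (r i) - 1)
   * prod_list (map (\<lambda>k. Pexc p a k (r k) (p (k+1) (r (k+1)) - 1)) [i..<j-1])
   * ainv (prod_list (map (\<lambda>k. Pexc p a k (r k) (p k (r k))) [i..<j]))
   * prod_list (map (\<lambda>k. Zev n lam x emb k (p k (r k))) [i..<j])
   * prod_list (map (\<lambda>k. eq k (r k)) [i..<j])"

definition fcoef :: "(nat \<Rightarrow> nat \<Rightarrow> 'b::ring_1) \<Rightarrow> (nat \<Rightarrow> nat \<Rightarrow> 'b) \<Rightarrow> (nat \<Rightarrow> nat)
    \<Rightarrow> nat \<Rightarrow> nat \<Rightarrow> (nat \<Rightarrow> nat) \<Rightarrow> 'b" where
  "fcoef p eqi a j i r =
     Pev p a j (p (j-1) (r (j-1)) + 1)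
   * prod_list (map (\<lambda>k. Pexc p a k (r k) (p (k-1) (r (k-1)) + 1)) [i+1..<j])
   * ainv (prod_list (map (\<lambda>k. Pexc p a k (r k) (p k (r k))) [i..<j]))
   * prod_list (map (\<lambda>k. eqi k (r k)) [i..<j])"

definition rtuples :: "(nat \<Rightarrow> nat) \<Rightarrow> nat \<Rightarrow> nat \<Rightarrow> (nat \<Rightarrow> nat) set" where
  "rtuples a i j = PiE {i..<j} (\<lambda>k. {1..a k})"

definition eD :: "nat \<Rightarrow> (nat \<Rightarrow> nat) \<Rightarrow> (nat \<Rightarrow> complex) \<Rightarrow> (complex \<Rightarrow> 'b::ring_1)
    \<Rightarrow> (nat \<Rightarrow> nat \<Rightarrow> 'b) \<Rightarrow> (nat \<Rightarrow> nat \<Rightarrow> 'b) \<Rightarrow> (nat \<Rightarrow> nat) \<Rightarrow> nat \<Rightarrow> nat \<Rightarrow> 'b fls" where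
  "eD n lam x emb p eq a i j =
     (if i = j then 1 else if i < j then
        - (\<Sum>r\<in>rtuples a i j. zres (p i (r i)) * fls_const (ecoef n lam x emb p eq a i j r))
      else 0)"

definition fD :: "(nat \<Rightarrow> nat \<Rightarrow> 'b::ring_1) \<Rightarrow> (nat \<Rightarrow> nat \<Rightarrow> 'b) \<Rightarrow> (nat \<Rightarrow> nat)
    \<Rightarrow> nat \<Rightarrow> nat \<Rightarrow> 'b fls" where
  "fD p eqi a j i =
     (if i = j then 1 else if i < j then
        (\<Sum>r\<in>rtuples a i j. zres (p i (r i) + 1) * fls_const (fcoef p eqi a j i r))
      else 0)"

definition TD :: "nat \<Rightarrow> (nat \<Rightarrow> nat) \<Rightarrow> (nat \<Rightarrow> complex) \<Rightarrow> (complex \<Rightarrow> 'b::ring_1)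
    \<Rightarrow> (nat \<Rightarrow> nat \<Rightarrow> 'b) \<Rightarrow> (nat \<Rightarrow> nat \<Rightarrow> 'b) \<Rightarrow> (nat \<Rightarrow> nat \<Rightarrow> 'b) \<Rightarrow> (nat \<Rightarrow> nat)
    \<Rightarrow> nat \<Rightarrow> nat \<Rightarrow> 'b fls" where
  "TD n lam x emb p eq eqi a \<alpha> \<beta> =
     (\<Sum>i\<in>{1..min \<alpha> \<beta>}. fD p eqi a \<alpha> i * gD n lam x emb p a i * eD n lam x emb p eq a i \<beta>)"

end

theory Submission
  imports Defs
begin

text \<open>
  Write \<open>T\<^sub>\<alpha>\<^sub>\<beta> = \<Sum>\<^sub>i f\<^sub>\<alpha>\<^sub>i g\<^sub>i e\<^sub>i\<^sub>\<beta>\<close>. The key point is that the entries of \<open>T\<close> are polynomials in \<open>z\<close> for any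
  divisor: expanding \<open>1 / P\<^sub>i\<^sub>-\<^sub>1(z - 1)\<close> in partial fractions splits the \<open>i\<close>-th summand into a part \<open>G\<^sub>i\<close> with
  poles at \<open>p\<^sub>i\<^sub>,\<^sub>r + 1\<close> and a part \<open>H\<^sub>i\<close> with poles at \<open>p\<^sub>i\<^sub>-\<^sub>1\<^sub>,\<^sub>r + 1\<close>, and the residues of \<open>G\<^sub>i\<close> and
  \<open>H\<^sub>i\<^sub>+\<^sub>1\<close> are opposite. Now \<open>g\<^sub>i\<close> has leading term \<open>z\<close> to the power \<open>-\<mu>\<^sub>n\<^sub>-\<^sub>i\<^sub>+\<^sub>1 \<le> 1\<close>, while off-diagonal
  \<open>e\<close> and \<open>f\<close> are \<open>O(1/z)\<close>. Hence only the summand \<open>i = min(\<alpha>,\<beta>)\<close> contributes to the polynomial part,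
  and its one or two leading coefficients give the formulas.
\<close>

subsection \<open>Commutants and partial fractions\<close>

text \<open>The relations are assumed in an arbitrary ring, so there is no field of rational
  functions in the \<open>p\<close>, no normal form, and there may be zero divisors. Hence every
  inverse in use is an explicit two-sided one, and "being a function of the \<open>p\<close>" is
  expressed by membership in a bicommutant. Only differences of variables of the same level are
  invertible, so the partial fractions must never divide by a difference of two levels.

  The poles meet because of the shifts: \<open>f\<close> carries \<open>eqi i s\<close>, which moves
  a zero at \<open>p i s\<close> to \<open>p i s + 1\<close>, and these points are the poles of the
  next \<open>g\<close>. The residues agree because \<open>eqi i s\<close> from \<open>f\<close>
  cancels \<open>eq i s\<close> from \<open>e\<close>; on its way it turns the factor
  \<open>Z_i\<close> at \<open>p i s\<close> in \<open>e\<close> into \<open>Z_i\<close> at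
  \<open>p i s + 1\<close>, which is the value of the additional factor in the next
  \<open>g\<close>.\<close>

definition commutant :: "'c::ring_1 set \<Rightarrow> 'c set" where
  "commutant S = {x. \<forall>s\<in>S. x * s = s * x}"

lemma commutantD: "x \<in> commutant S \<Longrightarrow> s \<in> S \<Longrightarrow> x * s = s * x"
  by (auto simp: commutant_def)

lemma commutantI: "(\<And>s. s \<in> S \<Longrightarrow> x * s = s * x) \<Longrightarrow> x \<in> commutant S"
  by (auto simp: commutant_def)

lemma commutant_add [simp, intro]: "x \<in> commutant S \<Longrightarrow> y \<in> commutant S \<Longrightarrow> x + y \<in> commutant S"
  by (auto simp: commutant_def algebra_simps)

lemma commutant_diff [simp, intro]: "x \<in> commutant S \<Longrightarrow> y \<in> commutant S \<Longrightarrow> x - y \<in> commutant S"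
  by (auto simp: commutant_def algebra_simps)

lemma commutant_mult [simp, intro]:
  assumes "x \<in> commutant S" "y \<in> commutant S"
  shows "x * y \<in> commutant S"
proof (rule commutantI)
  fix s assume s: "s \<in> S"
  show "x * y * s = s * (x * y)"
    using assms[THEN commutantD, OF s] by (metis mult.assoc)
qed

lemma commutant_0 [simp, intro]: "0 \<in> commutant S"
  and commutant_1 [simp, intro]: "1 \<in> commutant S"
  by (auto simp: commutant_def)

lemma commutant_uminus [simp, intro]: "x \<in> commutant S \<Longrightarrow> - x \<in> commutant S"
  by (auto simp: commutant_def)

lemma commutant_prod_list [simp, intro]: "(\<And>x. x \<in> set xs \<Longrightarrow> x \<in> commutant S) \<Longrightarrow> prod_list xs \<in> commutant S"
  by (induction xs) auto

lemma commutant_sum [simp, intro]: "(\<And>x. x \<in> A \<Longrightarrow> f x \<in> commutant S) \<Longrightarrow> sum f A \<in> commutant S"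
  by (induction A rule: infinite_finite_induct) auto

text \<open>Multiply \<open>u * s = s * u\<close> by \<open>v\<close> on both sides. Through this,
  bicommutants contain the inverses of differences of the \<open>p\<close> and the series
  \<open>zres c\<close>.\<close>

lemma commutant_inverse:
  assumes "u \<in> commutant S" "v * u = 1" "u * v = 1"
  shows "v \<in> commutant S"
proof (rule commutantI)
  fix s assume "s \<in> S"
  then have "v * (u * s) * v = v * (s * u) * v" using assms(1) by (simp add: commutantD)
  then show "v * s = s * v" using assms(2,3) by (metis mult.assoc mult_1_left mult_1_right)
qed

lemma commutant_antimono: "S \<subseteq> T \<Longrightarrow> commutant T \<subseteq> commutant S"
  by (auto simp: commutant_def)

text \<open>For a commuting set \<open>S\<close> the bicommutant is a commutative subring containing \<open>S\<close>, the centre and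
  all inverses of its elements; membership in it drives ordered rewriting with the commutative law.\<close>
lemma bicommutant_commute:
  assumes "S \<subseteq> commutant S" "x \<in> commutant (commutant S)" "y \<in> commutant (commutant S)"
  shows "x * y = y * x"
  using commutant_antimono[OF assms(1)] assms(2,3) commutantD[OF assms(2), of y] by blast

lemma bicommutant_incl: "x \<in> S \<Longrightarrow> x \<in> commutant (commutant S)"
  by (auto simp: commutant_def)

lemma bicommutant_central: "(\<And>y. x * y = y * x) \<Longrightarrow> x \<in> commutant (commutant S)"
  by (auto simp: commutant_def)

section \<open>Partial fractions in a commutative subring\<close>

locale commutative_subring =
  fixes C :: "'c::ring_1 set"
  assumes commute: "x \<in> C \<Longrightarrow> y \<in> C \<Longrightarrow> x * y = y * x"
    and mult_closed [simp, intro]: "x \<in> C \<Longrightarrow> y \<in> C \<Longrightarrow> x * y \<in> C"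
    and diff_closed [simp, intro]: "x \<in> C \<Longrightarrow> y \<in> C \<Longrightarrow> x - y \<in> C"
    and one_closed [simp, intro]: "1 \<in> C"
begin

lemma left_commute: "x \<in> C \<Longrightarrow> y \<in> C \<Longrightarrow> x * (y * w) = y * (x * w)"
  by (metis commute mult.assoc)

lemmas ac = mult.assoc commute left_commute

lemma prod_list_closed: "(\<And>x. x \<in> set xs \<Longrightarrow> x \<in> C) \<Longrightarrow> prod_list xs \<in> C"
  by (induction xs) auto

lemma prod_list_map_closed [simp, intro]: "(\<And>t. t \<in> set ss \<Longrightarrow> h t \<in> C) \<Longrightarrow> prod_list (map h ss) \<in> C"
  by (rule prod_list_closed) auto

lemma prod_list_remove:
  assumes "s \<in> set ss" "distinct ss" "\<And>t. t \<in> set ss \<Longrightarrow> h t \<in> C"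
  shows "prod_list (map h ss) = h s * prod_list (map h (filter (\<lambda>t. t \<noteq> s) ss))"
  using assms
proof (induction ss)
  case (Cons t ss)
  show ?case
  proof (cases "t = s")
    case True
    then have "filter (\<lambda>t. t \<noteq> s) ss = ss" using Cons.prems by (auto simp: filter_id_conv)
    with True show ?thesis by simp
  next
    case False
    with Cons show ?thesis by (simp add: left_commute)
  qed
qed simp

lemma prod_list_inverse:
  assumes "\<And>t. t \<in> set ss \<Longrightarrow> h t \<in> C" "\<And>t. t \<in> set ss \<Longrightarrow> k t \<in> C"
    "\<And>t. t \<in> set ss \<Longrightarrow> h t * k t = 1"
  shows "prod_list (map h ss) * prod_list (map k ss) = 1"
  using assms
proof (induction ss)
  case (Cons t ss)
  have "h t * prod_list (map h ss) * (k t * prod_list (map k ss))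
      = (h t * k t) * (prod_list (map h ss) * prod_list (map k ss))"
  proof -
    have "prod_list (map h ss) * (k t * prod_list (map k ss)) = k t * (prod_list (map h ss) * prod_list (map k ss))"
      by (rule left_commute) (use Cons.prems in auto)
    then show ?thesis by (simp add: mult.assoc)
  qed
  with Cons show ?case by simp
qed simp

lemma prod_list_remove_inverse:
  assumes "s \<in> set ss" "distinct ss"
    and "\<And>t. t \<in> set ss \<Longrightarrow> h t \<in> C" "\<And>t. t \<in> set ss \<Longrightarrow> k t \<in> C"
    and "\<And>t. t \<in> set ss \<Longrightarrow> k t * h t = 1"
  shows "prod_list (map h (filter (\<lambda>t. t \<noteq> s) ss)) * prod_list (map k ss) = k s"
proof -
  let ?M = "prod_list (map h (filter (\<lambda>t. t \<noteq> s) ss))" and ?J = "prod_list (map k ss)"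
  have "?M * ?J = k s * (h s * ?M) * ?J" using assms by (simp flip: mult.assoc)
  also have "\<dots> = k s * (prod_list (map h ss) * ?J)"
    using assms by (subst (2) prod_list_remove) (auto simp: mult.assoc)
  also have "prod_list (map h ss) * ?J = 1"
    by (rule prod_list_inverse) (use assms in \<open>auto simp: commute\<close>)
  finally show ?thesis by simp
qed

text \<open>Here \<open>c\<close> is a new node and \<open>k t\<close> the inverse of
  \<open>c - u t\<close>. Multiplying \<open>pf\<close> by all these inverses reduces each product
  with one factor left out to the single factor \<open>k s\<close>.\<close>

lemma lagrange_new_point:
  assumes "distinct ss"
    and "\<And>t. t \<in> set ss \<Longrightarrow> c - u t \<in> C" "\<And>t. t \<in> set ss \<Longrightarrow> k t \<in> C"
    and "\<And>t. t \<in> set ss \<Longrightarrow> k t * (c - u t) = 1"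
    and pf: "\<rho>0 * W * prod_list (map (\<lambda>t. c - u t) ss) =
      \<rho>0 - (\<Sum>s\<in>set ss. \<rho> s * (I s :: 'c) * prod_list (map (\<lambda>t. c - u t) (filter (\<lambda>t. t \<noteq> s) ss)))"
  shows "\<rho>0 * W = \<rho>0 * prod_list (map k ss) - (\<Sum>s\<in>set ss. \<rho> s * I s * k s)"
proof -
  have "prod_list (map (\<lambda>t. c - u t) ss) * prod_list (map k ss) = 1"
    by (rule prod_list_inverse) (use assms in \<open>auto simp: commute\<close>)
  then have "\<rho>0 * W = \<rho>0 * W * prod_list (map (\<lambda>t. c - u t) ss) * prod_list (map k ss)"
    by (simp add: mult.assoc)
  also have "\<dots> = \<rho>0 * prod_list (map k ss) - (\<Sum>s\<in>set ss. \<rho> s * I s * k s)"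
    unfolding pf using assms
    by (simp add: left_diff_distrib sum_distrib_right mult.assoc prod_list_remove_inverse)
  finally show ?thesis .
qed

lemma inverse_diff_flip:
  assumes "v \<in> C" "w \<in> C" "b \<in> C" "c \<in> C" "v * (b - c) = 1" "w * (c - b) = 1"
  shows "v = - w"
proof -
  have "v = v * ((c - b) * w)" using assms by (subst commute) auto
  also have "\<dots> = - (v * (b - c)) * w" by (simp add: algebra_simps)
  finally show ?thesis using assms by simp
qed

text \<open>Partial fractions in \<open>z\<close> with simple poles at \<open>d\<close> and at the
  nodes \<open>u s\<close>. The residue at \<open>u s\<close> has lost its factor
  \<open>d - u s\<close>, so no such difference is inverted: in the application \<open>d\<close> and
  the nodes come from adjacent levels, whose differences are not assumed invertible. The induction
  keeps \<open>d\<close> general because the hypothesis is also used at the added node.\<close>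

lemma lagrange_partial_fractions:
  assumes "distinct ss"
    and z: "z \<in> C" and u: "\<And>s. s \<in> set ss \<Longrightarrow> u s \<in> C" and rC: "\<And>s. s \<in> set ss \<Longrightarrow> \<rho> s \<in> C"
    and ivC: "\<And>s t. s \<in> set ss \<Longrightarrow> t \<in> set ss \<Longrightarrow> s \<noteq> t \<Longrightarrow> iv s t \<in> C"
    and r: "\<And>s. s \<in> set ss \<Longrightarrow> \<rho> s * (z - u s) = 1"
    and iv: "\<And>s t. s \<in> set ss \<Longrightarrow> t \<in> set ss \<Longrightarrow> s \<noteq> t \<Longrightarrow> iv s t * (u s - u t) = 1"
    and d: "d \<in> C" "\<delta> \<in> C" "\<delta> * (z - d) = 1"
  shows "\<delta> * prod_list (map \<rho> ss) * prod_list (map (\<lambda>t. d - u t) ss) =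
    \<delta> - (\<Sum>s\<in>set ss. \<rho> s * prod_list (map (iv s) (filter (\<lambda>t. t \<noteq> s) ss))
            * prod_list (map (\<lambda>t. d - u t) (filter (\<lambda>t. t \<noteq> s) ss)))"
  using assms
proof (induction ss arbitrary: d \<delta>)
  case (Cons s0 ss)
  note C = Cons.prems(2-)
  have d': "s0 \<notin> set ss" "distinct ss" using Cons.prems(1) by auto
  let ?W = "prod_list (map \<rho> ss)" and ?N = "\<lambda>d. prod_list (map (\<lambda>t. d - u t) ss)"
  let ?I = "\<lambda>s. prod_list (map (iv s) (filter (\<lambda>t. t \<noteq> s) ss))"
  let ?M = "\<lambda>d s. prod_list (map (\<lambda>t. d - u t) (filter (\<lambda>t. t \<noteq> s) ss))"
  let ?J = "prod_list (map (iv s0) ss)"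
  have IH: "\<delta> * ?W * ?N d = \<delta> - (\<Sum>s\<in>set ss. \<rho> s * ?I s * ?M d s)"
    if "d \<in> C" "\<delta> \<in> C" "\<delta> * (z - d) = 1" for d \<delta>
    by (rule Cons.IH) (use C that d' in auto)
  have cl [simp]: "u s0 \<in> C" "\<rho> s0 \<in> C" "z \<in> C" "d \<in> C" "\<delta> \<in> C"
    "\<And>s. s \<in> set ss \<Longrightarrow> iv s s0 \<in> C" "\<And>s. s \<in> set ss \<Longrightarrow> iv s0 s \<in> C"
    using C d' by auto
  have cl2 [simp]: "\<And>s. s \<in> set ss \<Longrightarrow> u s \<in> C" "\<And>s. s \<in> set ss \<Longrightarrow> \<rho> s \<in> C"
     "\<And>s t. s \<in> set ss \<Longrightarrow> t \<in> set ss \<Longrightarrow> s \<noteq> t \<Longrightarrow> iv s t \<in> C"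
    using C by auto
  have ivs: "iv s s0 * (u s - u s0) = 1" "iv s0 s * (u s0 - u s) = 1" "iv s0 s = - iv s s0" if "s \<in> set ss" for s
  proof -
    show 1: "iv s s0 * (u s - u s0) = 1" "iv s0 s * (u s0 - u s) = 1"
      using Cons.prems(7)[of s s0] Cons.prems(7)[of s0 s] d' that by auto
    show "iv s0 s = - iv s s0" by (rule inverse_diff_flip[of _ _ "u s0" "u s"]) (use 1 that in auto)
  qed
  have M: "?N d = (d - u s) * ?M d s" if "s \<in> set ss" "d \<in> C" for s d
    using prod_list_remove[OF that(1) d'(2), of "\<lambda>t. d - u t"] that by simp
  \<comment> \<open>The resolvent identity; it reduces the claim to the induction hypothesis at
    \<open>d\<close> and at \<open>u s0\<close>.\<close>
  have dr: "\<delta> * \<rho> s0 * (d - u s0) = \<delta> - \<rho> s0"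
  proof -
    have r0: "\<rho> s0 * (z - u s0) = 1" "\<delta> * (z - d) = 1" using C by auto
    have "\<delta> * \<rho> s0 * (d - u s0) = \<delta> * (\<rho> s0 * (z - u s0)) - \<rho> s0 * (\<delta> * (z - d))"
      by (simp add: algebra_simps commute left_commute)
    with r0 show ?thesis by simp
  qed
  \<comment> \<open>With \<open>d\<close> equal to the added node all differences are invertible, so
    the numerators can be divided out.\<close>
  have r0W: "\<rho> s0 * ?W = \<rho> s0 * ?J - (\<Sum>s\<in>set ss. \<rho> s * ?I s * iv s0 s)"
    by (rule lagrange_new_point[OF d'(2), where c = "u s0" and u = u])
      (use ivs(2) IH[of "u s0" "\<rho> s0"] C in auto)
  have "\<delta> * prod_list (map \<rho> (s0 # ss)) * prod_list (map (\<lambda>t. d - u t) (s0 # ss))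
      = (\<delta> * \<rho> s0 * (d - u s0)) * ?W * ?N d"
    by (simp add: ac)
  also have "\<dots> = \<delta> * ?W * ?N d - \<rho> s0 * ?W * ?N d" unfolding dr by (simp add: left_diff_distrib)
  also have "\<dots> = \<delta> - (\<Sum>s\<in>set ss. \<rho> s * ?I s * ?M d s)
      - (\<rho> s0 * ?J - (\<Sum>s\<in>set ss. \<rho> s * ?I s * iv s0 s)) * ?N d"
    using C by (subst IH) (auto simp: r0W)
  also have "\<dots> = \<delta> - (\<rho> s0 * ?J * ?N d + (\<Sum>s\<in>set ss. \<rho> s * ?I s * (?M d s - iv s0 s * ?N d)))"
    by (simp add: algebra_simps sum_subtractf sum_distrib_right)
  also have "(\<Sum>s\<in>set ss. \<rho> s * ?I s * (?M d s - iv s0 s * ?N d))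
     = (\<Sum>s\<in>set ss. \<rho> s * (iv s s0 * ?I s) * ((d - u s0) * ?M d s))"
  proof (rule sum.cong)
    fix s assume s: "s \<in> set ss"
    have "?M d s - iv s0 s * ?N d = iv s s0 * (u s - u s0) * ?M d s + iv s s0 * ((d - u s) * ?M d s)"
      using ivs[OF s] M[OF s] by simp
    also have "\<dots> = iv s s0 * ((d - u s0) * ?M d s)" by (simp add: algebra_simps)
    finally have "?M d s - iv s0 s * ?N d = iv s s0 * ((d - u s0) * ?M d s)" .
    moreover have "?I s * iv s s0 = iv s s0 * ?I s" using s by (intro commute prod_list_map_closed) auto
    ultimately show "\<rho> s * ?I s * (?M d s - iv s0 s * ?N d) = \<rho> s * (iv s s0 * ?I s) * ((d - u s0) * ?M d s)"
      by (metis mult.assoc)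
  qed simp
  finally have eq: "\<delta> * prod_list (map \<rho> (s0 # ss)) * prod_list (map (\<lambda>t. d - u t) (s0 # ss)) =
      \<delta> - (\<rho> s0 * ?J * ?N d + (\<Sum>s\<in>set ss. \<rho> s * (iv s s0 * ?I s) * ((d - u s0) * ?M d s)))" .
  have "filter (\<lambda>t. t \<noteq> s0) ss = ss" using d' by (auto simp: filter_id_conv)
  moreover have "s0 \<noteq> s" if "s \<in> set ss" for s using that d' by auto
  ultimately show ?case unfolding eq using d' by simp
qed simp

text \<open>The first node takes the role of \<open>d\<close> in the preceding identity. For an
  empty list the product would be \<open>1\<close> and the sum \<open>0\<close>.\<close>

lemma lagrange_inverse:
  assumes ss: "distinct ss" "ss \<noteq> []"
    and z: "z \<in> C" and u: "\<And>s. s \<in> set ss \<Longrightarrow> u s \<in> C" and rC: "\<And>s. s \<in> set ss \<Longrightarrow> \<rho> s \<in> C"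
    and ivC: "\<And>s t. s \<in> set ss \<Longrightarrow> t \<in> set ss \<Longrightarrow> s \<noteq> t \<Longrightarrow> iv s t \<in> C"
    and r: "\<And>s. s \<in> set ss \<Longrightarrow> \<rho> s * (z - u s) = 1"
    and iv: "\<And>s t. s \<in> set ss \<Longrightarrow> t \<in> set ss \<Longrightarrow> s \<noteq> t \<Longrightarrow> iv s t * (u s - u t) = 1"
  shows "prod_list (map \<rho> ss) = (\<Sum>s\<in>set ss. \<rho> s * prod_list (map (iv s) (filter (\<lambda>t. t \<noteq> s) ss)))"
proof -
  obtain s0 ss' where ss': "ss = s0 # ss'" using ss by (cases ss) auto
  let ?I = "\<lambda>s. prod_list (map (iv s) (filter (\<lambda>t. t \<noteq> s) ss'))"
  have d': "s0 \<notin> set ss'" "distinct ss'" using ss ss' by auto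
  have flip: "iv s0 s = - iv s s0" if "s \<in> set ss'" for s
    by (rule inverse_diff_flip[of _ _ "u s0" "u s"]) (use iv[of s s0] iv[of s0 s] that d' ss' u ivC in auto)
  have "\<rho> s0 * prod_list (map \<rho> ss') = \<rho> s0 * prod_list (map (iv s0) ss')
      - (\<Sum>s\<in>set ss'. \<rho> s * ?I s * iv s0 s)"
  proof (rule lagrange_new_point[OF d'(2), where c = "u s0" and u = u])
    show "iv s0 t * (u s0 - u t) = 1" if "t \<in> set ss'" for t
      using iv[of s0 t] that ss' d' by auto
    show "\<rho> s0 * prod_list (map \<rho> ss') * (\<Prod>t\<leftarrow>ss'. u s0 - u t) =
      \<rho> s0 - (\<Sum>s\<in>set ss'. \<rho> s * ?I s * (\<Prod>t\<leftarrow>filter (\<lambda>t. t \<noteq> s) ss'. u s0 - u t))"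
      by (rule lagrange_partial_fractions[where z = z]) (use assms ss' d' in auto)
  qed (use ss' d' u ivC in auto)
  also have "\<dots> = \<rho> s0 * prod_list (map (iv s0) ss') + (\<Sum>s\<in>set ss'. \<rho> s * (iv s s0 * ?I s))"
  proof -
    have "?I s * iv s s0 = iv s s0 * ?I s" if "s \<in> set ss'" for s
      using that d' ss' ivC by (intro commute prod_list_closed) auto
    then show ?thesis using flip by (simp add: mult.assoc sum_negf)
  qed
  finally have pf: "\<rho> s0 * prod_list (map \<rho> ss') =
      \<rho> s0 * prod_list (map (iv s0) ss') + (\<Sum>s\<in>set ss'. \<rho> s * (iv s s0 * ?I s))" .
  show ?thesis
  proof -
    have "filter (\<lambda>t. t \<noteq> s0) ss' = ss'" using d' by (auto simp: filter_id_conv)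
    moreover have "s0 \<noteq> s" if "s \<in> set ss'" for s using that d' by auto
    ultimately show ?thesis using d' pf unfolding ss' by simp
  qed
qed

end

notation fls_nth (infixl "$$" 75)

abbreviation K :: "'b::zero \<Rightarrow> 'b fls" where "K \<equiv> fls_const"

subsection \<open>Laurent series\<close>

lemma fls_times_nth_low:
  fixes f g :: "'b::ring_1 fls"
  assumes "\<And>j. j < k \<Longrightarrow> f $$ j = 0" "\<And>j. j < l \<Longrightarrow> g $$ j = 0"
  shows "(f * g) $$ m = (\<Sum>i=k..m-l. f $$ i * g $$ (m - i))"
proof -
  let ?h = "\<lambda>i. f $$ i * g $$ (m - i)"
  let ?A = "{fls_subdegree f..m - fls_subdegree g}"
  have z: "?h i = 0" if "i < k \<or> m - l < i \<or> i < fls_subdegree f \<or> m - fls_subdegree g < i" for i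
  proof -
    have "m - i < l \<or> m - i < fls_subdegree g \<or> i < k \<or> i < fls_subdegree f" using that by linarith
    then have "f $$ i = 0 \<or> g $$ (m - i) = 0" using assms fls_eq0_below_subdegree by metis
    then show ?thesis by auto
  qed
  have "(f * g) $$ m = sum ?h ?A" by (rule fls_times_nth(2))
  also have "\<dots> = sum ?h (?A \<inter> {k..m-l})"
  proof (rule sum.mono_neutral_right)
    show "\<forall>i\<in>?A - ?A \<inter> {k..m-l}. ?h i = 0" by (intro ballI z) fastforce
  qed auto
  also have "\<dots> = sum ?h {k..m-l}"
  proof (rule sum.mono_neutral_left)
    show "\<forall>i\<in>{k..m-l} - ?A \<inter> {k..m-l}. ?h i = 0" by (intro ballI z) fastforce
  qed auto
  finally show ?thesis .
qed

lemma zvar_times_nth [simp]: "(zvar * f) $$ k = f $$ (k + 1)" "(f * zvar) $$ k = f $$ (k + 1)"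
  by (simp_all add: zvar_def fls_X_inv_times_conv_shift)

lemma zvar_central: "zvar * f = f * zvar"
  by (rule fls_eqI) simp

lemma zvar_nth [simp]: "zvar $$ k = (if k = -1 then 1 else 0)"
  by (simp add: zvar_def)

lemma zres_nth: "zres c $$ k = (if k \<ge> 1 then c ^ nat (k - 1) else 0)"
  by (simp add: zres_def fls_X_times_conv_shift)

lemma zvar_diff_times_zres [simp]:
  "(zvar - K c) * zres c = 1" "zres c * (zvar - K c) = 1"
proof -
  have "c * c ^ nat (k - 1) = c ^ nat k \<and> c ^ nat (k - 1) * c = c ^ nat k" if "k \<ge> 1" for k :: int
  proof -
    from that have "nat k = Suc (nat (k - 1))" by auto
    then show ?thesis by (simp add: power_Suc2 flip: power_Suc)
  qed
  then show "(zvar - K c) * zres c = 1" "zres c * (zvar - K c) = 1"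
    by (auto intro!: fls_eqI simp: algebra_simps zres_nth)
qed

lemma K_prod_list: "K (prod_list xs) = prod_list (map K xs)"
  by (induction xs) (auto simp flip: fls_const_mult_const)

lemma K_sum: "K (sum f A) = (\<Sum>i\<in>A. K (f i :: 'b::comm_monoid_add))"
  by (induction A rule: infinite_finite_induct) (auto simp flip: fls_plus_const)

lemma K_diff: "K (x - y :: 'b::group_add) = K x - K y"
  by (rule fls_eqI) simp

lemma K_add: "K (x + y :: 'b::monoid_add) = K x + K y"
  by (rule fls_eqI) simp

text \<open>A series commuting with the constants \<open>K s\<close> has all its coefficients in the
  commutant of \<open>S\<close>, so it commutes with \<open>K c\<close> coefficient by
  coefficient.\<close>

lemma K_bicommutant: "c \<in> commutant (commutant S) \<Longrightarrow> K c \<in> commutant (commutant (K ` S))"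
proof (rule commutantI)
  fix y assume c: "c \<in> commutant (commutant S)" and y: "y \<in> commutant (K ` S)"
  have "y $$ k \<in> commutant S" for k
  proof (rule commutantI)
    fix s assume "s \<in> S"
    then have "y * K s = K s * y" using y by (auto dest: commutantD)
    then have "(y * K s) $$ k = (K s * y) $$ k" by (rule arg_cong)
    then show "y $$ k * s = s * y $$ k" by simp
  qed
  with c show "K c * y = y * K c"
    by (intro fls_eqI) (auto dest: commutantD)
qed

text \<open>The series variable is \<open>1/z\<close>, and only finitely many negative powers of it
  occur; so \<open>reg\<close> means polynomial in \<open>z\<close>.\<close>

definition reg :: "'b::ring_1 fls \<Rightarrow> bool" where
  "reg f \<longleftrightarrow> (\<forall>k>0. f $$ k = 0)"

lemma reg_K [simp, intro]: "reg (K c)"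
  and reg_zvar [simp, intro]: "reg zvar"
  and reg_0 [simp, intro]: "reg 0"
  and reg_1 [simp, intro]: "reg 1"
  by (auto simp: reg_def)

lemma reg_add [simp, intro]: "reg f \<Longrightarrow> reg g \<Longrightarrow> reg (f + g)"
  and reg_diff [simp, intro]: "reg f \<Longrightarrow> reg g \<Longrightarrow> reg (f - g)"
  and reg_uminus [simp, intro]: "reg f \<Longrightarrow> reg (- f)"
  by (auto simp: reg_def)

lemma reg_mult [simp, intro]:
  assumes "reg f" "reg g"
  shows "reg (f * g)"
  unfolding reg_def
proof (intro allI impI)
  fix k :: int assume "k > 0"
  then have "f $$ i * g $$ (k - i) = 0" for i
    using assms by (cases "i > 0") (auto simp: reg_def)
  then show "(f * g) $$ k = 0" by (simp add: fls_times_nth(2))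
qed

lemma reg_prod_list [simp, intro]: "(\<And>x. x \<in> set xs \<Longrightarrow> reg x) \<Longrightarrow> reg (prod_list xs)"
  by (induction xs) auto

lemma reg_sum [simp, intro]: "(\<And>x. x \<in> A \<Longrightarrow> reg (f x)) \<Longrightarrow> reg (sum f A)"
  by (induction A rule: infinite_finite_induct) auto

text \<open>\<open>evalsto c Q q\<close>: the polynomial \<open>Q\<close> takes the value \<open>q\<close> at \<open>z = c\<close>, with \<open>q\<close> commuting with \<open>c\<close>.\<close>
definition evalsto :: "'b::ring_1 \<Rightarrow> 'b fls \<Rightarrow> 'b \<Rightarrow> bool" where
  "evalsto c Q q \<longleftrightarrow> q * c = c * q \<and> reg Q \<and> (\<exists>Y. reg Y \<and> Q = K q + (zvar - K c) * Y)"

lemma evalsto_K: "q * c = c * q \<Longrightarrow> evalsto c (K q) q"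
  unfolding evalsto_def by (auto intro!: exI[of _ 0])

lemma evalsto_1: "evalsto c 1 1"
  using evalsto_K[of 1 c] by simp

lemma evalsto_zvar: "evalsto c zvar c"
  unfolding evalsto_def by (auto intro!: exI[of _ 1])

lemma evalsto_add:
  assumes "evalsto c P q" "evalsto c Q r"
  shows "evalsto c (P + Q) (q + r)"
proof -
  obtain Y W where YW: "reg Y" "reg W" "P = K q + (zvar - K c) * Y" "Q = K r + (zvar - K c) * W"
    using assms unfolding evalsto_def by auto
  have "P + Q = K (q + r) + (zvar - K c) * (Y + W)"
    unfolding YW by (simp add: algebra_simps K_add)
  moreover have "(q + r) * c = c * (q + r)" "reg (P + Q)"
    using assms by (auto simp: evalsto_def algebra_simps simp del: reg_add intro: reg_add)
  ultimately show ?thesis using YW reg_add[of Y W] unfolding evalsto_def by blast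
qed

lemma evalsto_diff:
  assumes "evalsto c P q" "evalsto c Q r"
  shows "evalsto c (P - Q) (q - r)"
proof -
  obtain Y W where YW: "reg Y" "reg W" "P = K q + (zvar - K c) * Y" "Q = K r + (zvar - K c) * W"
    using assms unfolding evalsto_def by auto
  have "P - Q = K (q - r) + (zvar - K c) * (Y - W)"
    unfolding YW by (simp add: algebra_simps K_diff)
  moreover have "(q - r) * c = c * (q - r)" "reg (P - Q)"
    using assms by (auto simp: evalsto_def algebra_simps simp del: reg_diff intro: reg_diff)
  ultimately show ?thesis using YW reg_diff[of Y W] unfolding evalsto_def by blast
qed

text \<open>The value \<open>q\<close> of the left factor has to move past
  \<open>zvar - K c\<close>; this is why \<open>evalsto\<close> records that \<open>q\<close>
  commutes with \<open>c\<close>.\<close>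

lemma evalsto_mult:
  assumes "evalsto c P q" "evalsto c Q r"
  shows "evalsto c (P * Q) (q * r)"
proof -
  obtain Y W where YW: "reg Y" "reg W" "P = K q + (zvar - K c) * Y" "Q = K r + (zvar - K c) * W"
    using assms unfolding evalsto_def by auto
  have q: "q * c = c * q" "r * c = c * r" and reg: "reg P" "reg Q"
    using assms by (simp_all add: evalsto_def)
  have "K q * (zvar - K c) = (zvar - K c) * K q"
    by (simp add: right_diff_distrib left_diff_distrib zvar_central q)
  then have "K q * Q = K (q * r) + (zvar - K c) * (K q * W)"
    unfolding YW(4) distrib_left by (simp flip: mult.assoc)
  then have "P * Q = K (q * r) + (zvar - K c) * (K q * W + Y * Q)"
    by (subst YW(3)) (simp add: distrib_left distrib_right mult.assoc)
  moreover have "q * r * c = c * (q * r)"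
    using q by (simp add: mult.assoc) (simp flip: mult.assoc)
  moreover have "reg (K q * W + Y * Q)" "reg (P * Q)" using YW(1,2) reg by simp_all
  ultimately show ?thesis unfolding evalsto_def by blast
qed

lemma evalsto_prod_list:
  "(\<And>t. t \<in> set ss \<Longrightarrow> evalsto c (F t) (h t)) \<Longrightarrow> evalsto c (prod_list (map F ss)) (prod_list (map h ss))"
  by (induction ss) (auto intro: evalsto_mult evalsto_1)

lemma evalsto_sum:
  "(\<And>t. t \<in> A \<Longrightarrow> evalsto c (F t) (h t)) \<Longrightarrow> evalsto c (sum F A) (sum h A)"
proof (induction A rule: infinite_finite_induct)
  case empty
  show ?case using evalsto_K[of 0 c] by simp
next
  case (infinite A)
  then show ?case using evalsto_K[of 0 c] by simp
qed (auto intro: evalsto_add)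

text \<open>The remainder theorem: modulo polynomials in \<open>z\<close>, a simple pole sees only
  the value of \<open>Q\<close>. Residues are compared in this form.\<close>

lemma evalsto_zres: 
  assumes "evalsto c Q q" shows "reg (zres c * (Q - K q))"
proof -
  obtain Y where Y: "reg Y" "Q = K q + (zvar - K c) * Y" using assms unfolding evalsto_def by auto
  have "zres c * (Q - K q) = (zres c * (zvar - K c)) * Y"
    unfolding Y(2) mult.assoc by simp
  then show ?thesis using Y by simp
qed

lemma zres_commutant:
  assumes "K c \<in> commutant S" shows "zres c \<in> commutant S"
proof (rule commutant_inverse[of "zvar - K c"])
  have "zvar \<in> commutant S" by (auto simp: commutant_def zvar_central)
  then show "zvar - K c \<in> commutant S" using assms by auto
qed auto

subsection \<open>Units\<close>

definition unit :: "'b::ring_1 \<Rightarrow> bool" where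
  "unit u \<longleftrightarrow> (\<exists>v. v * u = 1 \<and> u * v = 1)"

lemma ainv_eq: "v * u = 1 \<Longrightarrow> u * v = 1 \<Longrightarrow> ainv u = v" for u :: "'b::ring_1"
  unfolding ainv_def by (rule the_equality) (simp, metis mult.assoc mult_1_left mult_1_right)

lemma unit_ainv:
  assumes "unit u"
  shows "ainv u * u = 1" "u * ainv u = 1"
proof -
  obtain v where "v * u = 1" "u * v = 1" using assms unfolding unit_def by auto
  moreover from this have "ainv u = v" by (rule ainv_eq)
  ultimately show "ainv u * u = 1" "u * ainv u = 1" by simp_all
qed

lemma unit_mult:
  assumes "unit u" "unit v"
  shows "unit (u * v)" "ainv (u * v) = ainv v * ainv u"
proof -
  have "ainv v * ainv u * (u * v) = ainv v * (ainv u * u) * v"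
    "u * v * (ainv v * ainv u) = u * (v * ainv v) * ainv u" by (simp_all add: mult.assoc)
  then have *: "ainv v * ainv u * (u * v) = 1" "u * v * (ainv v * ainv u) = 1"
    using assms by (simp_all add: unit_ainv)
  then show "unit (u * v)" unfolding unit_def by blast
  show "ainv (u * v) = ainv v * ainv u" using * by (rule ainv_eq)
qed

lemma unit_1 [simp]: "unit 1" "ainv 1 = (1::'b::ring_1)"
  by (auto simp: unit_def intro: ainv_eq)

lemma unit_prod_list: "(\<And>x. x \<in> set xs \<Longrightarrow> unit x) \<Longrightarrow> unit (prod_list xs)"
  by (induction xs) (auto intro: unit_mult)

lemma commutant_ainv [simp, intro]: "u \<in> commutant S \<Longrightarrow> unit u \<Longrightarrow> ainv u \<in> commutant S"
  by (rule commutant_inverse) (auto simp: unit_ainv)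

lemma (in commutative_subring) ainv_prod_list:
  assumes "\<And>t. t \<in> set ss \<Longrightarrow> h t \<in> C" "\<And>t. t \<in> set ss \<Longrightarrow> ainv (h t) \<in> C" "\<And>t. t \<in> set ss \<Longrightarrow> unit (h t)"
  shows "ainv (prod_list (map h ss)) = prod_list (map (\<lambda>t. ainv (h t)) ss)"
  by (rule ainv_eq) (rule prod_list_inverse; use assms in \<open>auto simp: unit_ainv\<close>)+

lemma sum_rtuples:
  assumes "i < j"
  shows "(\<Sum>r\<in>rtuples a i j. h r) = (\<Sum>s\<in>{1..a i}. \<Sum>r\<in>rtuples a (i+1) j. h (r(i:=s)))"
proof -
  have 1: "{i..<j} = insert i {i+1..<j}" using assms by auto
  have "(\<Sum>r\<in>rtuples a i j. h r) = (\<Sum>(s,r)\<in>{1..a i} \<times> rtuples a (i+1) j. h (r(i:=s)))"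
    unfolding rtuples_def 1 PiE_insert_eq
    by (subst sum.reindex[OF inj_combinator]) (auto simp: case_prod_unfold)
  then show ?thesis by (simp add: sum.cartesian_product)
qed

subsection \<open>The relations of the algebra\<close>

lemma commutative_subring_bicommutant:
  assumes "S \<subseteq> commutant S"
  shows "commutative_subring (commutant (commutant S))"
proof
  fix x y assume "x \<in> commutant (commutant S)" "y \<in> commutant (commutant S)"
  then show "x * y = y * x" by (rule bicommutant_commute[OF assms])
qed auto

context commutative_subring
begin

text \<open>Primed factors will belong to levels above \<open>i\<close>. The functions commute among
  themselves, so the only other move is \<open>e\<close> past \<open>e'\<close>.\<close>

lemma regroup_e_coefficient:
  assumes "X \<in> C" "Z \<in> C" "X' \<in> C" "A' \<in> C" "Z' \<in> C" "A \<in> C" "e' * e = e * e'"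
  shows "(X * X') * (A' * A) * (Z * Z') * (e * e') = Z * A * (X * (X' * A' * Z' * e')) * e"
  using assms by (simp add: ac)

lemma regroup_f_coefficient:
  assumes "X \<in> C" "X' \<in> C" "A' \<in> C" "P \<in> C" "A \<in> C" "e' * e = e * e'" "e' * A = A * e'"
  shows "P * (X * X') * (A' * A) * (e * e') = X * (P * X' * A' * e') * A * e"
proof -
  have "X * (P * X' * A' * e') * A * e = X * (P * (X' * (A' * (e' * A * e))))" by (simp add: mult.assoc)
  also have "e' * A * e = A * (e * e')" using assms(6,7) by (simp add: mult.assoc)
  finally show ?thesis using assms(1-5) by (simp add: ac)
qed

end

section \<open>Difference operators of given levels\<close>

locale difference_operators =
  fixes n :: nat and a :: "nat \<Rightarrow> nat" and lam :: "nat \<Rightarrow> nat" and x :: "nat \<Rightarrow> complex"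
    and emb :: "complex \<Rightarrow> 'b::ring_1" and p eq eqi :: "nat \<Rightarrow> nat \<Rightarrow> 'b"
  assumes rel: "A_rel n a emb p eq eqi" and a_0: "a 0 = 0" and a_n: "a n = 0"
begin

text \<open>Levels \<open>0\<close> and \<open>n\<close> are allowed but carry no index, as
  \<open>a 0 = a n = 0\<close>; thus \<open>P_0 = P_n = 1\<close> needs no separate
  treatment.\<close>

definition idx :: "nat \<Rightarrow> nat \<Rightarrow> bool" where "idx i s \<longleftrightarrow> i \<le> n \<and> s \<in> {1..a i}"

lemma idx_D: "idx i s \<Longrightarrow> i \<in> {1..<n} \<and> s \<in> {1..a i}"
  using a_0 a_n unfolding idx_def by (cases "i = 0"; cases "i = n") auto

lemma emb_hom: "emb (c + d) = emb c + emb d" "emb (c * d) = emb c * emb d" "emb 1 = 1"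
  using rel unfolding A_rel_def by blast+

lemma emb_central: "emb c * y = y * emb c"
  using rel unfolding A_rel_def by blast+

lemma eq_eqi_commute:
  assumes "idx i r" "idx j s"
  shows "eq i r * eq j s = eq j s * eq i r" "eq i r * eqi j s = eqi j s * eq i r"
    "eqi j s * eq i r = eq i r * eqi j s"
    "eqi i r * eqi j s = eqi j s * eqi i r" "p i r * p j s = p j s * p i r"
  using rel idx_D[OF assms(1)] idx_D[OF assms(2)] unfolding A_rel_def by metis+

lemma eqi_eq: "idx i r \<Longrightarrow> eqi i r * eq i r = 1"
  using rel idx_D[of i r] unfolding A_rel_def by blast

lemma
  assumes "idx i r" "idx j s"
  shows eq_p: "eq i r * p j s = (if i = j \<and> r = s then p j s - 1 else p j s) * eq i r"
    and eqi_p: "eqi i r * p j s = (if i = j \<and> r = s then p j s + 1 else p j s) * eqi i r"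
proof -
  have "eq i r * p j s - p j s * eq i r = (if i = j \<and> r = s then - eq i r else 0)"
    "eqi i r * p j s - p j s * eqi i r = (if i = j \<and> r = s then eqi i r else 0)"
    using rel idx_D[OF assms(1)] idx_D[OF assms(2)] unfolding A_rel_def by blast+
  then show "eq i r * p j s = (if i = j \<and> r = s then p j s - 1 else p j s) * eq i r"
    "eqi i r * p j s = (if i = j \<and> r = s then p j s + 1 else p j s) * eqi i r"
    by (auto simp: algebra_simps split: if_splits)
qed

lemma unit_p_diff: 
  assumes "idx i r" "idx i s" "r \<noteq> s"
  shows "unit (p i r - p i s + of_int m)"
  using rel idx_D[OF assms(1)] idx_D[OF assms(2)] assms(3) unfolding A_rel_def unit_def by blast

text \<open>The subring \<open>low i\<close> plays the role of the subalgebra generated by the variables of level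
  at most \<open>i\<close>, and \<open>high i\<close> that of the subalgebra generated by the others.\<close>
definition gens :: "nat \<Rightarrow> 'b set" where
  "gens i = {y. \<exists>k\<le>i. \<exists>s. idx k s \<and> y \<in> {p k s, eq k s, eqi k s}}"

definition high :: "nat \<Rightarrow> 'b set" where "high i = commutant (gens i)"
definition low :: "nat \<Rightarrow> 'b set" where "low i = commutant (high i)"

text \<open>\<open>C0\<close> replaces the ring of functions of all the \<open>p\<close>: it
  contains them, the scalars and all inverses of its units. \<open>CC\<close> is its counterpart
  among Laurent series, which also contains \<open>zvar\<close> and \<open>zres c\<close> for
  \<open>c\<close> in \<open>C0\<close>.\<close>

definition S0 :: "'b set" where "S0 = {y. \<exists>k s. idx k s \<and> y = p k s}"
definition C0 :: "'b set" where "C0 = commutant (commutant S0)"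
definition CC :: "'b fls set" where "CC = commutant (commutant (K ` S0))"

lemma high_closed [simp, intro]:
  "c \<in> high i \<Longrightarrow> d \<in> high i \<Longrightarrow> c + d \<in> high i" "c \<in> high i \<Longrightarrow> d \<in> high i \<Longrightarrow> c - d \<in> high i"
  "c \<in> high i \<Longrightarrow> d \<in> high i \<Longrightarrow> c * d \<in> high i" "1 \<in> high i" "c \<in> high i \<Longrightarrow> unit c \<Longrightarrow> ainv c \<in> high i"
  "(\<And>x. x \<in> set xs \<Longrightarrow> x \<in> high i) \<Longrightarrow> prod_list xs \<in> high i" "(\<And>x. x \<in> A \<Longrightarrow> f x \<in> high i) \<Longrightarrow> sum f A \<in> high i"
  unfolding high_def by auto

lemma low_closed [simp, intro]:
  "c \<in> low i \<Longrightarrow> d \<in> low i \<Longrightarrow> c + d \<in> low i" "c \<in> low i \<Longrightarrow> d \<in> low i \<Longrightarrow> c - d \<in> low i"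
  "c \<in> low i \<Longrightarrow> d \<in> low i \<Longrightarrow> c * d \<in> low i" "1 \<in> low i" "c \<in> low i \<Longrightarrow> unit c \<Longrightarrow> ainv c \<in> low i"
  "(\<And>x. x \<in> set xs \<Longrightarrow> x \<in> low i) \<Longrightarrow> prod_list xs \<in> low i"
  unfolding low_def by auto

lemma high_low_commute: "c \<in> high i \<Longrightarrow> d \<in> low i \<Longrightarrow> c * d = d * c"
  unfolding low_def by (rule commutantD[symmetric])

lemma gens_low: "k \<le> i \<Longrightarrow> idx k s \<Longrightarrow> p k s \<in> low i \<and> eq k s \<in> low i \<and> eqi k s \<in> low i"
  unfolding low_def high_def by (intro conjI bicommutant_incl) (auto simp: gens_def)

lemma gens_high:
  assumes "i < k" "idx k s"
  shows "p k s \<in> high i \<and> eq k s \<in> high i \<and> eqi k s \<in> high i"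
proof -
  have "p k s * y = y * p k s \<and> eq k s * y = y * eq k s \<and> eqi k s * y = y * eqi k s" if y: "y \<in> gens i" for y
  proof -
    obtain l t where "l \<le> i" and l: "idx l t" "y \<in> {p l t, eq l t, eqi l t}"
      using y unfolding gens_def by blast
    then have "l \<noteq> k" using assms by auto
    with l(1) have "eq k s * p l t = p l t * eq k s" "eqi k s * p l t = p l t * eqi k s"
      "eq l t * p k s = p k s * eq l t" "eqi l t * p k s = p k s * eqi l t"
      using eq_p eqi_p assms(2) by auto
    with l(2) eq_eqi_commute[OF assms(2) l(1)] eq_eqi_commute[OF l(1) assms(2)] show ?thesis
      by (metis insertE singletonD)
  qed
  then show ?thesis by (auto simp: high_def commutant_def)
qed

lemma emb_high: "emb c \<in> high i" and emb_C0: "emb c \<in> C0"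
  by (simp_all add: high_def C0_def commutant_def) (metis emb_central)+

lemma p_C0: "idx k s \<Longrightarrow> p k s \<in> C0"
  unfolding C0_def by (rule bicommutant_incl) (auto simp: S0_def)

sublocale C0: commutative_subring C0
  unfolding C0_def
  by (rule commutative_subring_bicommutant) (auto simp: S0_def intro!: commutantI eq_eqi_commute)

sublocale CC: commutative_subring CC
  unfolding CC_def
  by (rule commutative_subring_bicommutant)
    (auto simp: S0_def intro!: commutantI arg_cong[where f = K] eq_eqi_commute)

lemma C0_closed [simp, intro]:
  "c \<in> C0 \<Longrightarrow> d \<in> C0 \<Longrightarrow> c + d \<in> C0" "c \<in> C0 \<Longrightarrow> unit c \<Longrightarrow> ainv c \<in> C0"
  unfolding C0_def by auto

lemma K_CC: "c \<in> C0 \<Longrightarrow> K c \<in> CC"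
  unfolding C0_def CC_def by (rule K_bicommutant)

lemma zvar_CC: "zvar \<in> CC"
  unfolding CC_def by (rule bicommutant_central) (rule zvar_central)

lemma zres_CC: "c \<in> C0 \<Longrightarrow> zres c \<in> CC"
  unfolding CC_def by (rule zres_commutant) (use K_CC CC_def in auto)

definition D :: "nat \<Rightarrow> nat \<Rightarrow> 'b" where "D i s = Pexc p a i s (p i s)"

text \<open>Besides \<open>m = 0\<close>, the case \<open>m = 1\<close> occurs because
  \<open>eqi i s\<close> carries \<open>p i s\<close> to \<open>p i s + 1\<close>.\<close>

lemma Pexc_shift_unit: "idx i s \<Longrightarrow> unit (Pexc p a i s (p i s + of_int m))"
  unfolding Pexc_def using unit_p_diff[of i s _ m]
  by (intro unit_prod_list) (auto simp: idx_def algebra_simps simp del: upt_Suc)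

lemma D_unit: "idx i s \<Longrightarrow> unit (D i s)"
  using Pexc_shift_unit[of i s 0] by (simp add: D_def)

lemma Pexc_C0: "i \<le> n \<Longrightarrow> c \<in> C0 \<Longrightarrow> Pexc p a i s c \<in> C0"
  unfolding Pexc_def by (intro C0.prod_list_map_closed C0.diff_closed p_C0) (auto simp: idx_def)

lemma Pev_C0: "i \<le> n \<Longrightarrow> c \<in> C0 \<Longrightarrow> Pev p a i c \<in> C0"
  unfolding Pev_def by (intro C0.prod_list_map_closed C0.diff_closed p_C0) (auto simp: idx_def)

lemma Zev_C0: "c \<in> C0 \<Longrightarrow> Zev n lam x emb k c \<in> C0"
  unfolding Zev_def by (intro C0.prod_list_map_closed C0.diff_closed emb_C0)

lemma Pexc_high: "i < k \<Longrightarrow> k \<le> n \<Longrightarrow> c \<in> high i \<Longrightarrow> Pexc p a k s c \<in> high i"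
  unfolding Pexc_def by (intro high_closed(6)) (use gens_high in \<open>auto simp: idx_def\<close>)

lemma Pev_high: "i < k \<Longrightarrow> k \<le> n \<Longrightarrow> c \<in> high i \<Longrightarrow> Pev p a k c \<in> high i"
  unfolding Pev_def by (intro high_closed(6)) (use gens_high in \<open>auto simp: idx_def\<close>)

lemma Zev_high: "c \<in> high i \<Longrightarrow> Zev n lam x emb k c \<in> high i"
  unfolding Zev_def by (intro high_closed(6)) (use emb_high in auto)

lemma Pexc_low: "k \<le> i \<Longrightarrow> k \<le> n \<Longrightarrow> c \<in> low i \<Longrightarrow> Pexc p a k s c \<in> low i"
  unfolding Pexc_def by (intro low_closed(6)) (use gens_low in \<open>auto simp: idx_def\<close>)

section \<open>Recursion in the level for the coefficients of e and f\<close>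

definition etail :: "nat \<Rightarrow> nat \<Rightarrow> (nat \<Rightarrow> nat) \<Rightarrow> 'b" where
  "etail i j r =
     prod_list (map (\<lambda>k. Pexc p a k (r k) (p (k+1) (r (k+1)) - 1)) [i..<j-1])
   * ainv (prod_list (map (\<lambda>k. Pexc p a k (r k) (p k (r k))) [i..<j]))
   * prod_list (map (\<lambda>k. Zev n lam x emb k (p k (r k))) [i..<j])
   * prod_list (map (\<lambda>k. eq k (r k)) [i..<j])"

text \<open>Only the first factor involves level \<open>i-1\<close>; \<open>etail\<close> lives on
  levels \<open>i\<close> and above and hence commutes with everything below.\<close>

lemma ecoef_etail: "ecoef n lam x emb p eq a i j r = Pev p a (i-1) (p i (r i) - 1) * etail i j r"
  unfolding ecoef_def etail_def by (simp add: mult.assoc)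

text \<open>With the index of level \<open>i\<close> fixed to \<open>s\<close>, \<open>Esum\<close> and \<open>Fsum\<close> are the coefficients of
  \<open>P\<^sub>i\<^sub>-\<^sub>1(p\<^sub>i\<^sub>,\<^sub>s - 1) / (z - p\<^sub>i\<^sub>,\<^sub>s)\<close> in \<open>-e\<^sub>i\<^sub>j\<close> and of \<open>1 / (z - p\<^sub>i\<^sub>,\<^sub>s - 1)\<close> in \<open>f\<^sub>j\<^sub>i\<close>. The polynomial \<open>Fpol\<close> is
  \<open>f\<^sub>j\<^sub>i P\<^sub>i\<close> with the shift operators moved to the right, \<open>Fval\<close> is its value at a point commuting with the
  coefficients, and \<open>Eres\<close> is the corresponding factor of the residue of \<open>g\<^sub>i e\<^sub>i\<^sub>j\<close> at \<open>p\<^sub>i\<^sub>-\<^sub>1\<^sub>,\<^sub>s + 1\<close>.\<close>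
definition Esum :: "nat \<Rightarrow> nat \<Rightarrow> nat \<Rightarrow> 'b" where
  "Esum j i s = (\<Sum>r\<in>rtuples a (i+1) j. etail i j (r(i:=s)))"

definition Fsum :: "nat \<Rightarrow> nat \<Rightarrow> nat \<Rightarrow> 'b" where
  "Fsum j i s = (\<Sum>r\<in>rtuples a (i+1) j. fcoef p eqi a j i (r(i:=s)))"

definition Eres :: "nat \<Rightarrow> nat \<Rightarrow> nat \<Rightarrow> 'b" where
  "Eres j i s = (if i = j then 1 else \<Sum>t\<in>{1..a i}. Pexc p a (i-1) s (p i t - 1) * Esum j i t)"

definition Fval :: "nat \<Rightarrow> nat \<Rightarrow> 'b \<Rightarrow> 'b" where
  "Fval j i c = (if i = j then Pev p a j c else \<Sum>t\<in>{1..a i}. Pexc p a i t c * Fsum j i t)"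

definition Fpol :: "nat \<Rightarrow> nat \<Rightarrow> 'b fls" where
  "Fpol j i = (if i = j then Pev (\<lambda>j r. K (p j r)) a j zvar
     else \<Sum>t\<in>{1..a i}. Pexc (\<lambda>j r. K (p j r)) a i t zvar * K (Fsum j i t))"

lemma rtuplesD: "r \<in> rtuples a i j \<Longrightarrow> i \<le> k \<Longrightarrow> k < j \<Longrightarrow> j \<le> n \<Longrightarrow> idx k (r k)"
  by (auto simp: rtuples_def idx_def PiE_def Pi_def)

lemma etail_high:
  assumes "r \<in> rtuples a i j" "h < i" "j \<le> n" shows "etail i j r \<in> high h"
proof -
  have V: "idx k (r k)" if "i \<le> k" "k < j" for k using rtuplesD assms that by blast
  show ?thesis unfolding etail_def
    by (intro high_closed(3,5,6) unit_prod_list) 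
      (use V assms in \<open>auto intro!: Pexc_high Zev_high high_closed(2) simp: gens_high D_unit[unfolded D_def]\<close>)
qed

lemma fcoef_high:
  assumes "r \<in> rtuples a i j" "h < i" "i < j" "j \<le> n" shows "fcoef p eqi a j i r \<in> high h"
proof -
  have V: "idx k (r k)" if "i \<le> k" "k < j" for k using rtuplesD assms that by blast
  show ?thesis unfolding fcoef_def
    by (intro high_closed(3,5,6) unit_prod_list) 
      (use V assms in \<open>auto intro!: Pexc_high Pev_high high_closed(1) simp: gens_high D_unit[unfolded D_def]\<close>)
qed

lemma rtuples_upd:
  assumes "r \<in> rtuples a (i+1) j" "s \<in> {1..a i}" "i < j"
  shows "r(i:=s) \<in> rtuples a i j"
  using assms by (fastforce simp: rtuples_def PiE_iff extensional_def)

lemma Esum_high: "h < i \<Longrightarrow> i < j \<Longrightarrow> j \<le> n \<Longrightarrow> s \<in> {1..a i} \<Longrightarrow> Esum j i s \<in> high h"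
  unfolding Esum_def by (intro high_closed(7) etail_high) (auto intro: rtuples_upd)

lemma Fsum_high: "h < i \<Longrightarrow> i < j \<Longrightarrow> j \<le> n \<Longrightarrow> s \<in> {1..a i} \<Longrightarrow> Fsum j i s \<in> high h"
  unfolding Fsum_def by (intro high_closed(7) fcoef_high) (auto intro: rtuples_upd)

lemma eq_prod_high:
  assumes "r \<in> rtuples a (i+1) j" "j \<le> n"
  shows "prod_list (map (\<lambda>k. eq k (r k)) [i+1..<j]) \<in> high i" "prod_list (map (\<lambda>k. eqi k (r k)) [i+1..<j]) \<in> high i"
  using rtuplesD[OF assms(1)] assms(2) gens_high by (auto intro!: high_closed(6))

text \<open>All functions precede all shift operators in \<open>etail\<close>. Level
  \<open>i\<close> can be peeled off because \<open>eq i s\<close> commutes with the shift operators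
  of higher levels and may go to the far right.\<close>

lemma etail_rec:
  assumes "1 \<le> i" "i < j" "j \<le> n" "idx i s" "r \<in> rtuples a (i+1) j"
  shows "etail i j (r(i:=s)) = Zev n lam x emb i (p i s) * ainv (D i s)
    * (if i + 1 = j then 1 else Pexc p a i s (p (i+1) (r (i+1)) - 1) * etail (i+1) j r) * eq i s"
proof (cases "i + 1 = j")
  case True
  have "[i..<j] = [i]" using True by (simp add: upt_conv_Cons flip: True)
  then show ?thesis using True assms C0.commute[OF Zev_C0[OF p_C0] C0_closed(2)[OF Pexc_C0[OF _ p_C0]]] D_unit
    by (auto simp: etail_def D_def idx_def)
next
  case False
  then have j: "i + 1 < j" using assms by auto
  have V: "idx k (r k)" if "i + 1 \<le> k" "k < j" for k using rtuplesD assms that by blast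
  have up: "[i..<j] = i # [i+1..<j]" "[i..<j-1] = i # [i+1..<j-1]" using j by (auto simp: upt_conv_Cons)
  let ?X = "Pexc p a i s (p (i+1) (r (i+1)) - 1)" and ?Z = "Zev n lam x emb i (p i s)"
    and ?X' = "prod_list (map (\<lambda>k. Pexc p a k (r k) (p (k+1) (r (k+1)) - 1)) [i+1..<j-1])"
    and ?D' = "prod_list (map (\<lambda>k. Pexc p a k (r k) (p k (r k))) [i+1..<j])"
    and ?Z' = "prod_list (map (\<lambda>k. Zev n lam x emb k (p k (r k))) [i+1..<j])"
    and ?e' = "prod_list (map (\<lambda>k. eq k (r k)) [i+1..<j])"
  have uD': "unit ?D'" using V D_unit[unfolded D_def] by (intro unit_prod_list) auto
  have C: "?X \<in> C0" "?Z \<in> C0" "?X' \<in> C0" "ainv ?D' \<in> C0" "?Z' \<in> C0" "ainv (D i s) \<in> C0"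
    using V assms j uD' D_unit[of i s] unfolding D_def
    by (auto intro!: Pexc_C0 Zev_C0 C0.prod_list_map_closed C0_closed C0.diff_closed C0.mult_closed p_C0 simp: idx_def)
  have e: "?e' * eq i s = eq i s * ?e'"
    by (rule high_low_commute[OF eq_prod_high(1)[OF assms(5,3)]]) (use gens_low assms in auto)
  have m: "map (\<lambda>k. h k ((r(i:=s)) k)) [i+1..<j] = map (\<lambda>k. h k (r k)) [i+1..<j]" for h :: "nat \<Rightarrow> nat \<Rightarrow> 'b"
    by (rule map_cong) auto
  have m': "map (\<lambda>k. h k ((r(i:=s)) k) ((r(i:=s)) (k+1))) [i+1..<j-1] = map (\<lambda>k. h k (r k) (r (k+1))) [i+1..<j-1]"
    for h :: "nat \<Rightarrow> nat \<Rightarrow> nat \<Rightarrow> 'b" by (rule map_cong) auto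
  have "etail i j (r(i:=s)) = (?X * ?X') * ainv (D i s * ?D') * (?Z * ?Z') * (eq i s * ?e')"
    unfolding etail_def up list.map prod_list.Cons m[of "\<lambda>k t. Pexc p a k t (p k t)"] m[of "\<lambda>k t. Zev n lam x emb k (p k t)"]
       m[of eq] m'[of "\<lambda>k t t'. Pexc p a k t (p (k+1) t' - 1)"] by (simp add: D_def)
  also have "ainv (D i s * ?D') = ainv ?D' * ainv (D i s)" using D_unit[OF assms(4)] uD' by (rule unit_mult)
  also have "(?X * ?X') * (ainv ?D' * ainv (D i s)) * (?Z * ?Z') * (eq i s * ?e')
      = ?Z * ainv (D i s) * (?X * (?X' * ainv ?D' * ?Z' * ?e')) * eq i s"
    using C e by (rule C0.regroup_e_coefficient)
  finally show ?thesis using False unfolding etail_def by simp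
qed

lemma fcoef_rec:
  assumes "1 \<le> i" "i < j" "j \<le> n" "idx i s" "r \<in> rtuples a (i+1) j"
  shows "fcoef p eqi a j i (r(i:=s)) = 
    (if i + 1 = j then Pev p a j (p i s + 1) else Pexc p a (i+1) (r (i+1)) (p i s + 1) * fcoef p eqi a j (i+1) r)
    * ainv (D i s) * eqi i s"
proof (cases "i + 1 = j")
  case True
  have "[i..<j] = [i]" using True by (simp add: upt_conv_Cons flip: True)
  then show ?thesis using True by (auto simp: fcoef_def D_def)
next
  case False
  then have j: "i + 1 < j" using assms by auto
  have V: "idx k (r k)" if "i + 1 \<le> k" "k < j" for k using rtuplesD assms that by blast
  have up: "[i..<j] = i # [i+1..<j]" "[i+1..<j] = (i+1) # [i+1+1..<j]" using j by (auto simp: upt_conv_Cons)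
  let ?X = "Pexc p a (i+1) (r (i+1)) (p i s + 1)" and ?P = "Pev p a j (p (j-1) (r (j-1)) + 1)"
    and ?X' = "prod_list (map (\<lambda>k. Pexc p a k (r k) (p (k-1) (r (k-1)) + 1)) [i+1+1..<j])"
    and ?D' = "prod_list (map (\<lambda>k. Pexc p a k (r k) (p k (r k))) [i+1..<j])"
    and ?e' = "prod_list (map (\<lambda>k. eqi k (r k)) [i+1..<j])"
  have uD': "unit ?D'" using V D_unit[unfolded D_def] by (intro unit_prod_list) auto
  have C: "?X \<in> C0" "?X' \<in> C0" "ainv ?D' \<in> C0" "?P \<in> C0" "ainv (D i s) \<in> C0"
    using V assms j uD' D_unit[of i s] unfolding D_def
    by (auto intro!: Pexc_C0 Pev_C0 C0.prod_list_map_closed C0_closed C0.diff_closed C0.mult_closed p_C0 simp: idx_def)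
  have "ainv (D i s) \<in> low i"
    using gens_low[of i i s] D_unit[of i s] assms unfolding D_def by (intro low_closed(5) Pexc_low) auto
  then have e: "?e' * eqi i s = eqi i s * ?e'" "?e' * ainv (D i s) = ainv (D i s) * ?e'"
    using high_low_commute[OF eq_prod_high(2)[OF assms(5,3)]] gens_low assms by auto
  have m: "map (\<lambda>k. h k ((r(i:=s)) k)) [i+1..<j] = map (\<lambda>k. h k (r k)) [i+1..<j]" for h :: "nat \<Rightarrow> nat \<Rightarrow> 'b"
    by (rule map_cong) auto
  have m': "map (\<lambda>k. h k ((r(i:=s)) k) ((r(i:=s)) (k-1))) [i+1+1..<j] = map (\<lambda>k. h k (r k) (r (k-1))) [i+1+1..<j]"
    for h :: "nat \<Rightarrow> nat \<Rightarrow> nat \<Rightarrow> 'b" by (rule map_cong) auto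
  have "map (\<lambda>k. Pexc p a k ((r(i:=s)) k) (p (k-1) ((r(i:=s)) (k-1)) + 1)) [i+1..<j] =
      ?X # map (\<lambda>k. Pexc p a k (r k) (p (k-1) (r (k-1)) + 1)) [i+1+1..<j]"
    unfolding up(2) list.map m'[of "\<lambda>k t t'. Pexc p a k t (p (k-1) t' + 1)"] by simp
  moreover have "j - 1 \<noteq> i" using j by auto
  ultimately have "fcoef p eqi a j i (r(i:=s)) = ?P * (?X * ?X') * ainv (D i s * ?D') * (eqi i s * ?e')"
    unfolding fcoef_def up(1) list.map m[of "\<lambda>k t. Pexc p a k t (p k t)"] m[of eqi] using j
    by (simp add: D_def)
  also have "ainv (D i s * ?D') = ainv ?D' * ainv (D i s)" using D_unit[OF assms(4)] uD' by (rule unit_mult)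
  also have "?P * (?X * ?X') * (ainv ?D' * ainv (D i s)) * (eqi i s * ?e')
      = ?X * (?P * ?X' * ainv ?D' * ?e') * ainv (D i s) * eqi i s"
    using C e by (rule C0.regroup_f_coefficient)
  finally show ?thesis using False unfolding fcoef_def by simp
qed

text \<open>Summed over the remaining indices, the coupling between levels \<open>i\<close> and
  \<open>i+1\<close> is exactly \<open>Eres\<close>, which also governs the residue of the next
  summand of \<open>T\<close>.\<close>

lemma Esum_rec:
  assumes "1 \<le> i" "i < j" "j \<le> n" "idx i s"
  shows "Esum j i s = Zev n lam x emb i (p i s) * ainv (D i s) * Eres j (i+1) s * eq i s"
proof (cases "i + 1 = j")
  case True
  then have "rtuples a (i+1) j = {\<lambda>_. undefined}" by (simp add: rtuples_def)
  then show ?thesis using True assms by (simp add: Esum_def Eres_def etail_rec del: fun_upd_apply)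
next
  case False
  then have *: "i + 1 < j" using assms by auto
  have "Esum j i s = (\<Sum>r\<in>rtuples a (i+1) j. Zev n lam x emb i (p i s) * ainv (D i s)
    * (Pexc p a i s (p (i+1) (r (i+1)) - 1) * etail (i+1) j r) * eq i s)"
    unfolding Esum_def by (rule sum.cong) (use assms etail_rec False in auto)
  also have "\<dots> = Zev n lam x emb i (p i s) * ainv (D i s)
    * (\<Sum>r\<in>rtuples a (i+1) j. Pexc p a i s (p (i+1) (r (i+1)) - 1) * etail (i+1) j r) * eq i s"
    by (simp add: sum_distrib_left sum_distrib_right mult.assoc)
  also have "(\<Sum>r\<in>rtuples a (i+1) j. Pexc p a i s (p (i+1) (r (i+1)) - 1) * etail (i+1) j r) = Eres j (i+1) s"
    unfolding sum_rtuples[OF *] Eres_def Esum_def using * by (simp add: sum_distrib_left)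
  finally show ?thesis .
qed

text \<open>Here the coupling is the value of the next polynomial \<open>Fpol\<close> at
  \<open>p i s + 1\<close>, the point where its residue will be taken.\<close>

lemma Fsum_rec:
  assumes "1 \<le> i" "i < j" "j \<le> n" "idx i s"
  shows "Fsum j i s = Fval j (i+1) (p i s + 1) * ainv (D i s) * eqi i s"
proof (cases "i + 1 = j")
  case True
  then have "rtuples a (i+1) j = {\<lambda>_. undefined}" by (simp add: rtuples_def)
  then show ?thesis using True assms by (simp add: Fsum_def Fval_def fcoef_rec del: fun_upd_apply)
next
  case False
  then have *: "i + 1 < j" using assms by auto
  have "Fsum j i s = (\<Sum>r\<in>rtuples a (i+1) j.
      (Pexc p a (i+1) (r (i+1)) (p i s + 1) * fcoef p eqi a j (i+1) r) * ainv (D i s) * eqi i s)"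
    unfolding Fsum_def by (rule sum.cong) (use assms fcoef_rec False in auto)
  also have "\<dots> = (\<Sum>r\<in>rtuples a (i+1) j. Pexc p a (i+1) (r (i+1)) (p i s + 1) * fcoef p eqi a j (i+1) r)
      * ainv (D i s) * eqi i s"
    by (simp add: sum_distrib_left sum_distrib_right mult.assoc)
  also have "(\<Sum>r\<in>rtuples a (i+1) j. Pexc p a (i+1) (r (i+1)) (p i s + 1) * fcoef p eqi a j (i+1) r)
      = Fval j (i+1) (p i s + 1)"
    unfolding sum_rtuples[OF *] Fval_def Fsum_def using * by (simp add: sum_distrib_left)
  finally show ?thesis .
qed

lemma eD_Esum:
  assumes "i < j"
  shows "eD n lam x emb p eq a i j = - (\<Sum>t\<in>{1..a i}. zres (p i t) * K (Pev p a (i-1) (p i t - 1)) * K (Esum j i t))"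
  using assms unfolding eD_def
  by (simp add: sum_rtuples ecoef_etail Esum_def sum_distrib_left K_sum mult.assoc flip: fls_const_mult_const)

lemma fD_Fsum:
  assumes "i < j"
  shows "fD p eqi a j i = (\<Sum>t\<in>{1..a i}. zres (p i t + 1) * K (Fsum j i t))"
  using assms unfolding fD_def by (simp add: sum_rtuples Fsum_def sum_distrib_left K_sum)

end

subsection \<open>Cancellation of poles\<close>

declare upt_Suc [simp del]

lemma prod_list_intertwine:
  assumes "\<And>t. t \<in> set ss \<Longrightarrow> y * f t = g t * y"
  shows "y * prod_list (map f ss) = prod_list (map g ss) * (y :: 'c::monoid_mult)"
  using assms
proof (induction ss)
  case (Cons t ss)
  have "y * (f t * prod_list (map f ss)) = g t * (y * prod_list (map f ss))"
    using Cons.prems by (simp flip: mult.assoc)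
  with Cons show ?case by (simp add: mult.assoc)
qed simp

context difference_operators
begin

abbreviation Kp :: "nat \<Rightarrow> nat \<Rightarrow> 'b fls" where "Kp \<equiv> \<lambda>j r. K (p j r)"

text \<open>\<open>bilev i\<close> stands for the functions of the level-\<open>i\<close> variables
  alone, \<open>lev i\<close> for whatever commutes with them. The latter contains \<open>C0\<close>
  and also the shift operators of higher levels, which occur in \<open>Fval\<close>.\<close>

definition lev :: "nat \<Rightarrow> 'b set" where "lev i = commutant {y. \<exists>t. idx i t \<and> y = p i t}"
definition bilev :: "nat \<Rightarrow> 'b set" where "bilev i = commutant (lev i)"

lemma bilev_closed [simp, intro]:
  "c \<in> bilev i \<Longrightarrow> d \<in> bilev i \<Longrightarrow> c + d \<in> bilev i" "c \<in> bilev i \<Longrightarrow> d \<in> bilev i \<Longrightarrow> c - d \<in> bilev i"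
  "c \<in> bilev i \<Longrightarrow> d \<in> bilev i \<Longrightarrow> c * d \<in> bilev i" "1 \<in> bilev i"
  "c \<in> bilev i \<Longrightarrow> unit c \<Longrightarrow> ainv c \<in> bilev i"
  "(\<And>x. x \<in> set xs \<Longrightarrow> x \<in> bilev i) \<Longrightarrow> prod_list xs \<in> bilev i"
  unfolding bilev_def by auto

lemma emb_bilev [simp, intro]: "emb w \<in> bilev i"
  unfolding bilev_def by (intro commutantI emb_central)

lemma p_bilev: "idx i t \<Longrightarrow> p i t \<in> bilev i"
  unfolding bilev_def lev_def by (rule bicommutant_incl) auto

lemma bilev_C0: "c \<in> bilev i \<Longrightarrow> c \<in> C0"
  unfolding bilev_def C0_def lev_def by (rule subsetD[OF commutant_antimono[OF commutant_antimono]]) (auto simp: S0_def)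

lemma lev_bilev_commute: "c \<in> lev i \<Longrightarrow> d \<in> bilev i \<Longrightarrow> c * d = d * c"
  unfolding bilev_def by (rule commutantD[symmetric])

lemma high_lev: "c \<in> high i \<Longrightarrow> c \<in> lev i"
  unfolding high_def lev_def by (rule subsetD[OF commutant_antimono]) (auto simp: gens_def)

lemma C0_lev: "c \<in> C0 \<Longrightarrow> c \<in> lev i"
  unfolding lev_def by (intro commutantI C0.commute) (auto intro: p_C0)

lemma Pexc_bilev: "i \<le> n \<Longrightarrow> c \<in> bilev i \<Longrightarrow> Pexc p a i s c \<in> bilev i"
  unfolding Pexc_def by (intro bilev_closed(6)) (use p_bilev in \<open>auto simp: idx_def\<close>)

lemma Zev_bilev: "c \<in> bilev i \<Longrightarrow> Zev n lam x emb k c \<in> bilev i"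
  unfolding Zev_def by (intro bilev_closed(6)) auto

definition Zlt :: "nat \<Rightarrow> 'b fls" where
  "Zlt i = prod_list (map (\<lambda>k. Zev n lam x (\<lambda>c. K (emb c)) k zvar) [0..<i])"

definition zlt :: "nat \<Rightarrow> 'b \<Rightarrow> 'b" where
  "zlt i c = prod_list (map (\<lambda>k. Zev n lam x emb k c) [0..<i])"

definition W :: "nat \<Rightarrow> 'b fls" where
  "W i = prod_list (map (\<lambda>r. zres (p i r + 1)) [1..<Suc (a i)])"

lemma K_emb_central: "K (emb c) * f = f * K (emb c)"
  by (rule fls_eqI) (simp add: emb_central)

lemma Zlt_central: "Zlt i * f = f * Zlt i"
proof -
  have "zvar \<in> commutant {f}" "K (emb c) \<in> commutant {f}" for c
    by (auto simp: commutant_def zvar_central K_emb_central)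
  then have "Zlt i \<in> commutant {f}"
    unfolding Zlt_def Zev_def by (auto intro!: commutant_prod_list)
  then show ?thesis by (auto simp: commutant_def)
qed

lemma reg_Zlt [simp, intro]: "reg (Zlt i)"
  unfolding Zlt_def Zev_def by (auto intro!: reg_prod_list)

lemma reg_Pev [simp, intro]: "reg (Pev Kp a i zvar)"
  and reg_Pexc [simp, intro]: "reg (Pexc Kp a i s zvar)"
  unfolding Pev_def Pexc_def by (auto intro!: reg_prod_list)

lemma Zlt_Suc: "Zlt (Suc i) = Zlt i * Zev n lam x (\<lambda>c. K (emb c)) i zvar"
  and zlt_Suc: "zlt (Suc i) c = zlt i c * Zev n lam x emb i c"
  by (simp_all add: Zlt_def zlt_def upt_Suc)

lemma evalsto_Zlt: "evalsto c (Zlt i) (zlt i c)"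
  unfolding Zlt_def zlt_def Zev_def
  by (intro evalsto_prod_list evalsto_diff evalsto_zvar evalsto_K) (rule emb_central)

lemma zlt_bilev: "c \<in> bilev i \<Longrightarrow> zlt k c \<in> bilev i"
  unfolding zlt_def by (intro bilev_closed(6)) (auto intro: Zev_bilev)

lemma evalsto_Pexc:
  assumes "\<And>t. idx i t \<Longrightarrow> p i t * c = c * p i t" "i \<le> n"
  shows "evalsto c (Pexc Kp a i s zvar) (Pexc p a i s c)" "evalsto c (Pev Kp a i zvar) (Pev p a i c)"
  unfolding Pexc_def Pev_def using assms
  by (auto intro!: evalsto_prod_list evalsto_diff evalsto_zvar evalsto_K simp: idx_def)

lemma gD_eq: "gD n lam x emb p a i = Pev Kp a i zvar * W (i - 1) * Zlt i"
  unfolding gD_def W_def Zlt_def ..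

lemma Kp_CC: "idx i s \<Longrightarrow> Kp i s \<in> CC"
  by (intro K_CC p_C0)

lemma Pev_remove:
  assumes "idx i s"
  shows "Pev Kp a i zvar = (zvar - Kp i s) * Pexc Kp a i s zvar"
  unfolding Pev_def Pexc_def
  by (rule CC.prod_list_remove) (use assms Kp_CC zvar_CC in \<open>auto simp: idx_def\<close>)

lemma Pexc_remove:
  assumes "idx i s" "s \<noteq> t"
  shows "\<exists>Y. reg Y \<and> Pexc Kp a i t zvar = (zvar - Kp i s) * Y"
proof -
  have "Pexc Kp a i t zvar = (zvar - Kp i s)
    * prod_list (map (\<lambda>r. zvar - Kp i r) (filter (\<lambda>r. r \<noteq> s) (filter (\<lambda>r. r \<noteq> t) [1..<Suc (a i)])))"
    unfolding Pexc_def by (rule CC.prod_list_remove) (use assms Kp_CC zvar_CC idx_D in \<open>auto simp: idx_def\<close>)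
  moreover have "reg (prod_list (map (\<lambda>r. zvar - Kp i r) (filter (\<lambda>r. r \<noteq> s) (filter (\<lambda>r. r \<noteq> t) [1..<Suc (a i)]))))"
    by (auto intro!: reg_prod_list)
  ultimately show ?thesis by blast
qed

text \<open>Besides functions of the \<open>p\<close>, only operators of levels above
  \<open>i\<close> enter, and neither moves a variable of level \<open>i\<close>.\<close>

lemma Fval_lev:
  assumes "i + 1 \<le> j" "j \<le> n" "idx i s"
  shows "Fval j (i+1) (p i s + 1) \<in> lev i"
proof -
  have c: "p i s + 1 \<in> C0" using p_C0[OF assms(3)] by auto
  have "Pexc p a (i+1) t (p i s + 1) * Fsum j (i+1) t \<in> lev i" if "i + 1 \<noteq> j" "t \<in> {1..a (i+1)}" for t
    unfolding lev_def
  proof (rule commutant_mult; fold lev_def)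
    show "Pexc p a (i+1) t (p i s + 1) \<in> lev i" by (intro C0_lev Pexc_C0 c) (use assms in auto)
    show "Fsum j (i+1) t \<in> lev i" by (intro high_lev Fsum_high) (use assms that in auto)
  qed
  moreover have "Pev p a j (p i s + 1) \<in> lev i"
    using assms c by (intro C0_lev Pev_C0) auto
  ultimately show ?thesis unfolding Fval_def by (auto simp: lev_def)
qed

text \<open>The trailing \<open>eqi i s\<close> is the only factor of \<open>Fsum j i s\<close> that
  can fail to commute with the level-\<open>i\<close> variables.\<close>

lemma Fsum_p:
  assumes "1 \<le> i" "i < j" "j \<le> n" "idx i s" "idx i t"
  shows "Fsum j i s * p i t = (if s = t then p i t + 1 else p i t) * Fsum j i s"
proof -
  let ?\<phi> = "Fval j (i+1) (p i s + 1)" and ?p = "if s = t then p i t + 1 else p i t"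
  have p: "?p \<in> bilev i" "p i s \<in> bilev i" using p_bilev assms by auto
  have A: "ainv (D i s) \<in> bilev i" unfolding D_def using assms p D_unit[of i s, unfolded D_def]
    by (intro bilev_closed(5) Pexc_bilev) auto
  have "Fsum j i s * p i t = ?\<phi> * (ainv (D i s) * ?p) * eqi i s"
    using assms by (simp add: Fsum_rec mult.assoc eqi_p)
  also have "ainv (D i s) * ?p = ?p * ainv (D i s)" using A p bilev_C0 by (intro C0.commute) auto
  also have "?\<phi> * (?p * ainv (D i s)) * eqi i s = (?\<phi> * ?p) * (ainv (D i s) * eqi i s)"
    by (simp only: mult.assoc)
  also have "?\<phi> * ?p = ?p * ?\<phi>" using p assms by (intro lev_bilev_commute[of _ i] Fval_lev) auto
  finally show ?thesis using assms by (simp only: Fsum_rec mult.assoc)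
qed

lemma K_Fsum_zvar:
  assumes "1 \<le> i" "i < j" "j \<le> n" "idx i s"
  shows "K (Fsum j i s) * (zvar - Kp i s) = (zvar - K (p i s + 1)) * K (Fsum j i s)"
  using Fsum_p[OF assms assms(4)]
  by (simp add: right_diff_distrib left_diff_distrib zvar_central)

lemma K_Fsum_Pexc:
  assumes "1 \<le> i" "i < j" "j \<le> n" "idx i s"
  shows "K (Fsum j i s) * Pexc Kp a i s zvar = Pexc Kp a i s zvar * K (Fsum j i s)"
proof -
  have "zvar - Kp i t \<in> commutant {K (Fsum j i s)}" if "idx i t" "t \<noteq> s" for t
    using Fsum_p[OF assms that(1)] that(2)
    by (auto simp: commutant_def right_diff_distrib left_diff_distrib zvar_central)
  then have "Pexc Kp a i s zvar \<in> commutant {K (Fsum j i s)}"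
    unfolding Pexc_def using assms(4) by (auto intro!: commutant_prod_list simp: idx_def)
  then show ?thesis by (auto simp: commutant_def)
qed

text \<open>The zero of \<open>P_i\<close> at \<open>p i t\<close> arrives at
  \<open>p i t + 1\<close> after crossing the shift in \<open>Fsum\<close>, and there it cancels the
  pole of \<open>fD\<close>.\<close>

lemma fD_Pev:
  assumes "1 \<le> i" "i \<le> j" "j \<le> n"
  shows "fD p eqi a j i * Pev Kp a i zvar = Fpol j i"
proof (cases "i = j")
  case True
  then show ?thesis by (simp add: fD_def Fpol_def)
next
  case False
  then have ij: "i < j" using assms by auto
  have "zres (p i t + 1) * K (Fsum j i t) * Pev Kp a i zvar = Pexc Kp a i t zvar * K (Fsum j i t)"
    if "t \<in> {1..a i}" for t
  proof -
    have V: "idx i t" using that assms by (auto simp: idx_def)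
    have "zres (p i t + 1) * K (Fsum j i t) * Pev Kp a i zvar
        = zres (p i t + 1) * (K (Fsum j i t) * (zvar - Kp i t)) * Pexc Kp a i t zvar"
      by (simp only: Pev_remove[OF V] mult.assoc)
    also have "\<dots> = (zres (p i t + 1) * (zvar - K (p i t + 1))) * (K (Fsum j i t) * Pexc Kp a i t zvar)"
      unfolding K_Fsum_zvar[OF assms(1) ij assms(3) V] by (simp only: mult.assoc)
    finally show ?thesis unfolding K_Fsum_Pexc[OF assms(1) ij assms(3) V] by simp
  qed
  then show ?thesis using False ij by (simp add: fD_Fsum Fpol_def sum_distrib_right)
qed

lemma reg_Fpol [simp, intro]: "reg (Fpol j i)"
  unfolding Fpol_def by auto

lemma evalsto_Fpol:
  assumes "i + 1 \<le> j" "j \<le> n" "idx i s"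
  shows "evalsto (p i s + 1) (Fpol j (i+1)) (Fval j (i+1) (p i s + 1))"
proof -
  have c: "p i s + 1 \<in> C0" using p_C0[OF assms(3)] by auto
  have *: "p (i+1) t * (p i s + 1) = (p i s + 1) * p (i+1) t" if "idx (i+1) t" for t
    using p_C0[OF that] c by (rule C0.commute)
  have "Fsum j (i+1) t * (p i s + 1) = (p i s + 1) * Fsum j (i+1) t" if "i + 1 \<noteq> j" "t \<in> {1..a (i+1)}" for t
    using that assms gens_low[of i i s] by (intro high_low_commute[of _ i] Fsum_high low_closed) auto
  moreover note evalsto_Pexc[of "i+1" "p i s + 1", OF *]
  ultimately show ?thesis using assms unfolding Fpol_def Fval_def
    by (auto intro!: evalsto_sum evalsto_mult evalsto_K)
qed

text \<open>\<open>Eres j (i+1) s\<close> does not involve \<open>p i s\<close>: its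
  level-\<open>i\<close> factors omit the index \<open>s\<close>, and the rest lies above level
  \<open>i\<close>.\<close>

lemma eqi_Eres:
  assumes "i + 1 \<le> j" "j \<le> n" "idx i s"
  shows "eqi i s * Eres j (i+1) s = Eres j (i+1) s * eqi i s"
proof -
  have "Eres j (i+1) s \<in> commutant {eqi i s}"
  proof (cases "i + 1 = j")
    case False
    have "Pexc p a i s (p (i+1) t - 1) * Esum j (i+1) t \<in> commutant {eqi i s}" if "t \<in> {1..a (i+1)}" for t
    proof (rule commutant_mult)
      have V: "idx (i+1) t" using that assms by (auto simp: idx_def)
      have "Esum j (i+1) t * eqi i s = eqi i s * Esum j (i+1) t"
        using that assms False gens_low[of i i s] by (intro high_low_commute[of _ i] Esum_high) auto
      then show "Esum j (i+1) t \<in> commutant {eqi i s}" by (auto simp: commutant_def)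
      have "p (i+1) t * eqi i s = eqi i s * p (i+1) t"
        using V assms gens_low[of i i s] gens_high[of i "i+1" t] by (intro high_low_commute[of _ i]) auto
      then have "p (i+1) t - 1 \<in> commutant {eqi i s}" by (auto simp: commutant_def algebra_simps)
      moreover have "p i r \<in> commutant {eqi i s}" if "idx i r" "r \<noteq> s" for r
        using eqi_p[OF assms(3) that(1)] that(2) by (auto simp: commutant_def)
      ultimately show "Pexc p a i s (p (i+1) t - 1) \<in> commutant {eqi i s}"
        unfolding Pexc_def using assms by (intro commutant_prod_list) (auto simp: idx_def)
    qed
    then show ?thesis using False unfolding Eres_def by auto
  qed (auto simp: Eres_def)
  then show ?thesis by (auto simp: commutant_def)
qed

lemma eqi_shift:
  assumes "idx i s"
  shows "eqi i s * Zev n lam x emb k (p i s) = Zev n lam x emb k (p i s + 1) * eqi i s"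
    "eqi i s * ainv (D i s) = ainv (Pexc p a i s (p i s + 1)) * eqi i s"
proof -
  have p: "eqi i s * p i s = (p i s + 1) * eqi i s" using eqi_p[OF assms assms] by simp
  show "eqi i s * Zev n lam x emb k (p i s) = Zev n lam x emb k (p i s + 1) * eqi i s"
    unfolding Zev_def
    by (rule prod_list_intertwine) (simp add: right_diff_distrib left_diff_distrib p emb_central)
  let ?P = "Pexc p a i s (p i s + 1)"
  have u: "unit (D i s)" "unit ?P" using D_unit[OF assms] Pexc_shift_unit[OF assms, of 1] by auto
  have "eqi i s * (p i s - p i t) = (p i s + 1 - p i t) * eqi i s" if "idx i t" "t \<noteq> s" for t
    using eqi_p[OF assms that(1)] that(2) by (simp add: right_diff_distrib left_diff_distrib p)
  then have "eqi i s * D i s = ?P * eqi i s"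
    unfolding D_def Pexc_def by (intro prod_list_intertwine) (use assms in \<open>auto simp: idx_def\<close>)
  then have "ainv ?P * (eqi i s * D i s) * ainv (D i s) = ainv ?P * (?P * eqi i s) * ainv (D i s)" by simp
  moreover have "ainv ?P * (eqi i s * D i s) * ainv (D i s) = ainv ?P * eqi i s * (D i s * ainv (D i s))"
    "ainv ?P * (?P * eqi i s) * ainv (D i s) = (ainv ?P * ?P) * (eqi i s * ainv (D i s))"
    by (simp_all only: mult.assoc)
  ultimately show "eqi i s * ainv (D i s) = ainv ?P * eqi i s" using u by (simp add: unit_ainv)
qed

text \<open>On its way to the right \<open>eqi i s\<close> shifts \<open>p i s\<close> by one, until
  it meets and cancels \<open>eq i s\<close>; no shift operator of level \<open>i\<close>
  remains.\<close>

lemma Fsum_Esum: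
  assumes "1 \<le> i" "i < j" "i < k" "j \<le> n" "k \<le> n" "idx i s"
  shows "Fsum j i s * Esum k i s = Fval j (i+1) (p i s + 1) * ainv (D i s)
    * Zev n lam x emb i (p i s + 1) * ainv (Pexc p a i s (p i s + 1)) * Eres k (i+1) s"
proof -
  let ?e = "eqi i s" and ?Z = "Zev n lam x emb i" and ?A = "ainv (D i s)" and ?B = "Eres k (i+1) s"
    and ?A' = "ainv (Pexc p a i s (p i s + 1))"
  have "?e * ?Z (p i s) * ?A * ?B * eq i s = ?Z (p i s + 1) * (?e * ?A) * ?B * eq i s"
    by (simp only: eqi_shift[OF assms(6)] mult.assoc)
  also have "\<dots> = ?Z (p i s + 1) * ?A' * (?e * ?B) * eq i s"
    by (simp only: eqi_shift[OF assms(6)] mult.assoc)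
  also have "?e * ?B = ?B * ?e" using assms by (intro eqi_Eres) auto
  also have "?Z (p i s + 1) * ?A' * (?B * ?e) * eq i s = ?Z (p i s + 1) * ?A' * ?B"
    by (simp add: mult.assoc eqi_eq[OF assms(6)])
  finally show ?thesis using assms by (simp add: Fsum_rec Esum_rec mult.assoc)
qed

section \<open>Comparison of the residues of adjacent summands\<close>

definition G :: "nat \<Rightarrow> nat \<Rightarrow> nat \<Rightarrow> 'b fls" where
  "G j k i = (if i < k then - (fD p eqi a j i * Zlt i * (\<Sum>t\<in>{1..a i}. Pexc Kp a i t zvar * K (Esum k i t))) else 0)"

text \<open>Both parts arise from expanding \<open>W (i-1)\<close> next to the pole of
  \<open>eD\<close> at \<open>p i t\<close>: in \<open>G\<close> this pole is kept and cancels a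
  factor of \<open>P_i\<close>, while \<open>H\<close> collects the nodes of \<open>W\<close>. For
  \<open>i = k\<close> there is no such pole, so \<open>G\<close> is zero and \<open>H\<close> comes
  from \<open>W\<close> alone.\<close>

definition H :: "nat \<Rightarrow> nat \<Rightarrow> nat \<Rightarrow> 'b fls" where
  "H j k i = Fpol j i * Zlt i *
     (\<Sum>s\<in>{1..a (i-1)}. zres (p (i-1) s + 1) * K (ainv (D (i-1) s)) * K (Eres k i s))"

text \<open>The product omitting \<open>t\<close> still has a zero at \<open>p i s\<close>; crossing
  \<open>Fsum\<close> it moves to \<open>p i s + 1\<close> and cancels the pole.\<close>

lemma off_diagonal_reg:
  assumes "1 \<le> i" "i < j" "j \<le> n" "idx i s" "s \<noteq> t"
  shows "reg (zres (p i s + 1) * K (Fsum j i s) * Zlt i * (Pexc Kp a i t zvar * K c))"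
proof -
  obtain Y where Y: "reg Y" "Pexc Kp a i t zvar = (zvar - Kp i s) * Y"
    using Pexc_remove[OF assms(4,5)] by auto
  have "zres (p i s + 1) * K (Fsum j i s) * Zlt i * (Pexc Kp a i t zvar * K c)
    = zres (p i s + 1) * (K (Fsum j i s) * (zvar - Kp i s)) * Zlt i * Y * K c"
    unfolding Y(2) by (simp add: mult.assoc Zlt_central[of _ "Y * _"] Zlt_central[of _ "_ * (Y * _)"])
  also have "\<dots> = (zres (p i s + 1) * (zvar - K (p i s + 1))) * K (Fsum j i s) * Zlt i * Y * K c"
    unfolding K_Fsum_zvar[OF assms(1-4)] by (simp only: mult.assoc)
  finally show ?thesis using Y by simp
qed

text \<open>Modulo polynomials, both terms have a simple pole at \<open>c = p i s + 1\<close> with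
  the same residue \<open>?\<phi> * zlt (i+1) c * ?A * ?B\<close>.\<close>

lemma diagonal_reg:
  assumes "1 \<le> i" "i < j" "i < k" "j \<le> n" "k \<le> n" "idx i s"
  shows "reg (Fpol j (i+1) * Zlt (i+1) * (zres (p i s + 1) * K (ainv (D i s)) * K (Eres k (i+1) s))
    - zres (p i s + 1) * K (Fsum j i s) * Zlt i * (Pexc Kp a i s zvar * K (Esum k i s)))"
proof -
  define c where "c = p i s + 1"
  let ?\<phi> = "Fval j (i+1) c" and ?A = "ainv (D i s)" and ?B = "Eres k (i+1) s"
    and ?P = "Pexc p a i s c" and ?Z = "Zev n lam x emb i c"
  have c: "c \<in> bilev i" using p_bilev[OF assms(6)] by (auto simp: c_def)
  have "i \<le> n" using assms by auto
  have u: "unit (D i s)" "unit ?P"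
    using D_unit[OF assms(6)] Pexc_shift_unit[OF assms(6), of 1] by (auto simp: c_def)
  have b: "?A \<in> bilev i" "?P \<in> bilev i" "?Z \<in> bilev i" "zlt i c \<in> bilev i" "ainv ?P \<in> bilev i"
    using u c p_bilev[OF assms(6)] \<open>i \<le> n\<close> unfolding D_def by (auto intro: Pexc_bilev Zev_bilev zlt_bilev)
  have \<phi>: "?\<phi> \<in> lev i" unfolding c_def by (rule Fval_lev) (use assms in auto)
  have e1: "evalsto c (Fpol j (i+1) * Zlt (i+1)) (?\<phi> * zlt (i+1) c)"
    unfolding c_def using assms by (intro evalsto_mult evalsto_Fpol evalsto_Zlt) auto
  have e2: "evalsto c (Zlt i * Pexc Kp a i s zvar) (zlt i c * ?P)"
    using \<open>i \<le> n\<close> p_C0 bilev_C0[OF c] by (intro evalsto_mult evalsto_Zlt evalsto_Pexc C0.commute) auto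
  let ?Q1 = "Fpol j (i+1) * Zlt (i+1)" and ?Q2 = "Zlt i * Pexc Kp a i s zvar"
  \<comment> \<open>\<open>evalsto_zres\<close> expects the pole on the left, so
    \<open>zres c\<close> must pass \<open>Fpol\<close>, whose coefficients lie above level
    \<open>i\<close> and commute with \<open>c\<close>.\<close>
  have "K c * Fpol j (i+1) = Fpol j (i+1) * K c"
  proof -
    have "K (p (i+1) t) \<in> commutant {K c}" if "idx (i+1) t" for t
      using C0.commute[OF p_C0[OF that] bilev_C0[OF c]] by (auto simp: commutant_def)
    moreover have "K (Fsum j (i+1) t) \<in> commutant {K c}" if "i + 1 \<noteq> j" "t \<in> {1..a (i+1)}" for t
      using lev_bilev_commute[OF high_lev c, OF Fsum_high, of "i+1" j t] that assms by (auto simp: commutant_def)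
    moreover have "zvar \<in> commutant {K c}" by (auto simp: commutant_def zvar_central)
    ultimately have "Fpol j (i+1) \<in> commutant {K c}"
      using assms unfolding Fpol_def Pev_def Pexc_def
      by (auto intro!: commutant_sum commutant_mult commutant_prod_list commutant_diff simp: idx_def)
    then show ?thesis by (auto simp: commutant_def)
  qed
  then have "zres c \<in> commutant {Fpol j (i+1)}"
    by (intro zres_commutant) (auto simp: commutant_def)
  then have z: "Fpol j (i+1) * zres c = zres c * Fpol j (i+1)" by (auto simp: commutant_def)
  have "?Q1 * (zres c * K ?A * K ?B) = Fpol j (i+1) * (Zlt (i+1) * zres c) * (K ?A * K ?B)"
    by (simp only: mult.assoc)
  also have "\<dots> = (Fpol j (i+1) * zres c) * Zlt (i+1) * (K ?A * K ?B)"
    unfolding Zlt_central[of _ "zres c"] by (simp only: mult.assoc)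
  also have "\<dots> = zres c * ?Q1 * K (?A * ?B)" unfolding z by (simp add: mult.assoc)
  also have "\<dots> = zres c * (?Q1 - K (?\<phi> * zlt (i+1) c)) * K (?A * ?B) + zres c * K (?\<phi> * zlt (i+1) c * ?A * ?B)"
    by (simp add: left_diff_distrib right_diff_distrib mult.assoc flip: fls_const_mult_const)
  finally have 1: "reg (?Q1 * (zres c * K ?A * K ?B) - zres c * K (?\<phi> * zlt (i+1) c * ?A * ?B))"
    using evalsto_zres[OF e1] by simp
  have "zres c * K (Fsum j i s) * Zlt i * (Pexc Kp a i s zvar * K (Esum k i s))
      = zres c * (K (Fsum j i s) * Zlt i) * (Pexc Kp a i s zvar * K (Esum k i s))"
    by (simp only: mult.assoc)
  also have "K (Fsum j i s) * Zlt i = Zlt i * K (Fsum j i s)" by (rule Zlt_central[symmetric])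
  also have "zres c * (Zlt i * K (Fsum j i s)) * (Pexc Kp a i s zvar * K (Esum k i s))
      = zres c * Zlt i * (K (Fsum j i s) * Pexc Kp a i s zvar) * K (Esum k i s)"
    by (simp only: mult.assoc)
  also have "\<dots> = zres c * ?Q2 * K (Fsum j i s * Esum k i s)"
    using assms by (simp add: K_Fsum_Pexc mult.assoc)
  also have "\<dots> = zres c * (?Q2 - K (zlt i c * ?P)) * K (Fsum j i s * Esum k i s)
      + zres c * K (zlt i c * ?P * (Fsum j i s * Esum k i s))"
    by (simp add: left_diff_distrib right_diff_distrib mult.assoc flip: fls_const_mult_const)
  \<comment> \<open>The value \<open>?P\<close> cancels the shifted inverse from
    \<open>Esum\<close>, and \<open>?Z\<close> extends \<open>zlt i\<close> to
    \<open>zlt (i+1)\<close>.\<close>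
  also have "zlt i c * ?P * (Fsum j i s * Esum k i s) = ?\<phi> * zlt (i+1) c * ?A * ?B"
  proof -
    have C: "?A \<in> C0" "?P \<in> C0" "?Z \<in> C0" "zlt i c \<in> C0" "ainv ?P \<in> C0" using b bilev_C0 by auto
    have "zlt i c * ?P * (Fsum j i s * Esum k i s) = (zlt i c * ?P * ?\<phi>) * (?A * ?Z * ainv ?P) * ?B"
      using assms unfolding c_def by (simp add: Fsum_Esum mult.assoc)
    also have "zlt i c * ?P * ?\<phi> = ?\<phi> * (zlt i c * ?P)"
      using lev_bilev_commute[OF \<phi>, of "zlt i c * ?P"] b by auto
    also have "?\<phi> * (zlt i c * ?P) * (?A * ?Z * ainv ?P) * ?B = ?\<phi> * (zlt i c * ?Z * ?A) * (?P * ainv ?P) * ?B"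
      using C by (simp add: C0.ac)
    finally show ?thesis using u by (simp add: unit_ainv zlt_Suc mult.assoc)
  qed
  finally have 2: "reg (zres c * K (Fsum j i s) * Zlt i * (Pexc Kp a i s zvar * K (Esum k i s))
      - zres c * K (?\<phi> * zlt (i+1) c * ?A * ?B))"
    using evalsto_zres[OF e2] by simp
  show ?thesis using reg_diff[OF 1 2] by (simp add: c_def)
qed

text \<open>\<open>G\<close> is a double sum over the poles of \<open>f\<close> and the terms of
  \<open>e\<close>. Its off-diagonal part is polynomial, and its diagonal cancels against
  \<open>H\<close> term by term.\<close>

lemma G_H_reg:
  assumes "1 \<le> i" "i < j" "i < k" "j \<le> n" "k \<le> n"
  shows "reg (G j k i + H j k (i+1))"
proof -
  let ?g = "\<lambda>s t. zres (p i s + 1) * K (Fsum j i s) * Zlt i * (Pexc Kp a i t zvar * K (Esum k i t))"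
  let ?h = "\<lambda>s. Fpol j (i+1) * Zlt (i+1) * (zres (p i s + 1) * K (ainv (D i s)) * K (Eres k (i+1) s))"
  have "G j k i = - (\<Sum>s\<in>{1..a i}. \<Sum>t\<in>{1..a i}. ?g s t)"
    using assms by (simp add: G_def fD_Fsum sum_distrib_left sum_distrib_right mult.assoc) (rule sum.swap)
  moreover have "H j k (i+1) = (\<Sum>s\<in>{1..a i}. ?h s)"
    by (simp add: H_def sum_distrib_left)
  ultimately have "G j k i + H j k (i+1) = (\<Sum>s\<in>{1..a i}. ?h s - (\<Sum>t\<in>{1..a i}. ?g s t))"
    by (simp add: sum_subtractf)
  also have "\<dots> = (\<Sum>s\<in>{1..a i}. (?h s - ?g s s) - (\<Sum>t\<in>{1..a i} - {s}. ?g s t))"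
    by (rule sum.cong) (simp_all add: sum.remove algebra_simps)
  also have "reg \<dots>"
    using assms by (intro reg_sum reg_diff[OF diagonal_reg] off_diagonal_reg) (auto simp: idx_def)
  finally show ?thesis .
qed

text \<open>The nodes are \<open>p i s + 1\<close>, so the numerators at \<open>c\<close> are
  \<open>(c - 1) - p i s\<close>; this is the role of the factor \<open>P_{i-1}(p_{i,r} - 1)\<close>
  in \<open>e\<close>. The second claim is an equality unless \<open>a i = 0\<close>, where
  \<open>W i = 1\<close> and the sum is empty.\<close>

lemma W_lagrange:
  assumes "i \<le> n" "c \<in> C0"
  shows "zres c * W i * K (Pev p a i (c - 1)) =
    zres c - (\<Sum>s\<in>{1..a i}. zres (p i s + 1) * K (ainv (D i s)) * K (Pexc p a i s (c - 1)))" (is ?th1)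
    and "reg (W i - (\<Sum>s\<in>{1..a i}. zres (p i s + 1) * K (ainv (D i s))))" (is ?th2)
proof -
  define ss where "ss = [1..<Suc (a i)]"
  have set: "set ss = {1..a i}" and dist: "distinct ss" unfolding ss_def by auto
  have W: "W i = prod_list (map (\<lambda>s. zres (p i s + 1)) ss)"
    and P: "Pev p a i e = prod_list (map (\<lambda>t. e - p i t) ss)"
      "Pexc p a i s e = prod_list (map (\<lambda>t. e - p i t) (filter (\<lambda>t. t \<noteq> s) ss))" for e s
    unfolding W_def Pev_def Pexc_def ss_def by simp_all
  let ?iv = "\<lambda>s t. K (ainv (p i s - p i t))"
  have V: "idx i s" if "s \<in> set ss" for s using that assms set by (auto simp: idx_def)
  have ud: "unit (p i s - p i t)" if "s \<in> set ss" "t \<in> set ss" "s \<noteq> t" for s t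
    using unit_p_diff[of i s t 0] V that by auto
  have A: "prod_list (map (?iv s) (filter (\<lambda>t. t \<noteq> s) ss)) = K (ainv (D i s))" if "s \<in> set ss" for s
    unfolding D_def P
    by (subst C0.ainv_prod_list) (use that V ud p_C0 in \<open>auto simp: K_prod_list o_def\<close>)
  have CCs: "K (p i s + 1) \<in> CC" "zres (p i s + 1) \<in> CC" if "s \<in> set ss" for s
    using V[OF that] p_C0 by (auto intro!: K_CC zres_CC)
  have ivCC: "?iv s t \<in> CC" if "s \<in> set ss" "t \<in> set ss" "s \<noteq> t" for s t
    using that V p_C0 ud by (auto intro!: K_CC)
  have iv: "?iv s t * (K (p i s + 1) - K (p i t + 1)) = 1" if "s \<in> set ss" "t \<in> set ss" "s \<noteq> t" for s t
    using unit_ainv(1)[OF ud[OF that]] by (simp flip: K_diff)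
  have d: "K c - K (p i t + 1) = K (c - 1 - p i t)" for t by (simp add: algebra_simps flip: K_diff)
  have "zres c * prod_list (map (\<lambda>s. zres (p i s + 1)) ss) * prod_list (map (\<lambda>t. K c - K (p i t + 1)) ss) =
    zres c - (\<Sum>s\<in>set ss. zres (p i s + 1) * prod_list (map (?iv s) (filter (\<lambda>t. t \<noteq> s) ss))
            * prod_list (map (\<lambda>t. K c - K (p i t + 1)) (filter (\<lambda>t. t \<noteq> s) ss)))"
    by (rule CC.lagrange_partial_fractions[where z = zvar])
      (use dist CCs ivCC iv zvar_CC assms in \<open>auto intro!: K_CC zres_CC\<close>)
  also have "(\<Sum>s\<in>set ss. zres (p i s + 1) * prod_list (map (?iv s) (filter (\<lambda>t. t \<noteq> s) ss))
            * prod_list (map (\<lambda>t. K c - K (p i t + 1)) (filter (\<lambda>t. t \<noteq> s) ss)))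
     = (\<Sum>s\<in>{1..a i}. zres (p i s + 1) * K (ainv (D i s)) * K (Pexc p a i s (c - 1)))"
    unfolding set[symmetric] by (rule sum.cong) (simp_all add: A d P K_prod_list o_def)
  finally show ?th1 unfolding d by (simp add: W P K_prod_list o_def)
  show ?th2
  proof (cases "a i = 0")
    case True
    then show ?thesis by (simp add: W ss_def)
  next
    case False
    have "W i = (\<Sum>s\<in>set ss. zres (p i s + 1) * prod_list (map (?iv s) (filter (\<lambda>t. t \<noteq> s) ss)))"
      unfolding W by (rule CC.lagrange_inverse[where z = zvar and u = "\<lambda>s. K (p i s + 1)"])
        (use CCs ivCC iv zvar_CC False in \<open>auto simp: ss_def\<close>)
    also have "\<dots> = (\<Sum>s\<in>{1..a i}. zres (p i s + 1) * K (ainv (D i s)))"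
      unfolding set[symmetric] by (rule sum.cong) (simp_all add: A)
    finally show ?thesis by simp
  qed
qed

text \<open>For \<open>i < k\<close> the difference is even zero. A polynomial defect can appear
  only for \<open>i = k\<close>, from the expansion of \<open>W\<close>.\<close>

lemma term_reg:
  assumes "1 \<le> i" "i \<le> j" "i \<le> k" "j \<le> n" "k \<le> n"
  shows "reg (fD p eqi a j i * gD n lam x emb p a i * eD n lam x emb p eq a i k - (G j k i + H j k i))"
proof (cases "i = k")
  case True
  let ?S = "\<Sum>s\<in>{1..a (i-1)}. zres (p (i-1) s + 1) * K (ainv (D (i-1) s))"
  have "fD p eqi a j i * gD n lam x emb p a i = Fpol j i * W (i-1) * Zlt i"
    using fD_Pev[of i j] assms by (simp add: gD_eq flip: mult.assoc)
  also have "\<dots> = Fpol j i * Zlt i * W (i-1)" using Zlt_central[of i "W (i-1)"] by (simp add: mult.assoc)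
  finally have "fD p eqi a j i * gD n lam x emb p a i * eD n lam x emb p eq a i k - (G j k i + H j k i)
      = Fpol j i * Zlt i * (W (i-1) - ?S)"
    using True by (simp add: eD_def G_def H_def Eres_def right_diff_distrib)
  then show ?thesis using W_lagrange(2)[of "i-1" 1] assms by auto
next
  case False
  then have ik: "i < k" using assms by auto
  let ?f = "fD p eqi a j i" and ?P = "Pev Kp a i zvar"
  let ?N = "\<lambda>t. K (Pev p a (i-1) (p i t - 1))" and ?E = "\<lambda>t. K (Esum k i t)"
  let ?h = "\<lambda>s t. zres (p (i-1) s + 1) * K (ainv (D (i-1) s)) * K (Pexc p a (i-1) s (p i t - 1))"
  have fg: "?f * gD n lam x emb p a i * (zres (p i t) * ?N t * ?E t)
     = ?f * Zlt i * (Pexc Kp a i t zvar * ?E t) - Fpol j i * Zlt i * (\<Sum>s\<in>{1..a (i-1)}. ?h s t * ?E t)"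
    if "t \<in> {1..a i}" for t
  proof -
    have V: "idx i t" using that assms by (auto simp: idx_def)
    have C: "zres (p i t) \<in> CC" "W (i-1) \<in> CC" "?P \<in> CC" "Pexc Kp a i t zvar \<in> CC" "Kp i t \<in> CC"
      unfolding W_def Pev_def Pexc_def using assms p_C0 p_C0[OF V]
      by (auto intro!: zres_CC CC.prod_list_map_closed zvar_CC K_CC simp: idx_def)
    have Pz: "?P * zres (p i t) = Pexc Kp a i t zvar"
    proof -
      have "?P * zres (p i t) = (zvar - Kp i t) * (Pexc Kp a i t zvar * zres (p i t))"
        by (simp only: Pev_remove[OF V] mult.assoc)
      also have "\<dots> = (zvar - Kp i t) * (zres (p i t) * Pexc Kp a i t zvar)"
        using C by (simp add: CC.commute)
      also have "\<dots> = ((zvar - Kp i t) * zres (p i t)) * Pexc Kp a i t zvar" by (simp only: mult.assoc)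
      finally show ?thesis by simp
    qed
    have "?f * gD n lam x emb p a i * (zres (p i t) * ?N t * ?E t)
      = ?f * ?P * (W (i-1) * Zlt i) * (zres (p i t) * ?N t * ?E t)"
      by (simp only: gD_eq mult.assoc)
    also have "W (i-1) * Zlt i = Zlt i * W (i-1)" by (rule Zlt_central[symmetric])
    also have "?f * ?P * (Zlt i * W (i-1)) * (zres (p i t) * ?N t * ?E t)
      = ?f * ?P * Zlt i * (W (i-1) * zres (p i t)) * ?N t * ?E t"
      by (simp only: mult.assoc)
    also have "W (i-1) * zres (p i t) = zres (p i t) * W (i-1)" using C by (intro CC.commute)
    also have "?f * ?P * Zlt i * (zres (p i t) * W (i-1)) * ?N t * ?E t
      = ?f * ?P * Zlt i * (zres (p i t) * W (i-1) * ?N t) * ?E t" by (simp only: mult.assoc)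
    also have "zres (p i t) * W (i-1) * ?N t = zres (p i t) - (\<Sum>s\<in>{1..a (i-1)}. ?h s t)"
      using assms V p_C0 by (intro W_lagrange) auto
    also have "?f * ?P * Zlt i * (zres (p i t) - (\<Sum>s\<in>{1..a (i-1)}. ?h s t)) * ?E t
      = ?f * (?P * Zlt i) * zres (p i t) * ?E t - (?f * ?P) * Zlt i * (\<Sum>s\<in>{1..a (i-1)}. ?h s t * ?E t)"
      by (simp only: right_diff_distrib left_diff_distrib mult.assoc sum_distrib_right)
    also have "?f * ?P = Fpol j i" using assms by (intro fD_Pev) auto
    also have "?P * Zlt i = Zlt i * ?P" by (rule Zlt_central[symmetric])
    also have "?f * (Zlt i * ?P) * zres (p i t) * ?E t = ?f * Zlt i * (?P * zres (p i t) * ?E t)"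
      by (simp only: mult.assoc)
    finally show ?thesis unfolding Pz .
  qed
  have "?f * gD n lam x emb p a i * eD n lam x emb p eq a i k
    = - (\<Sum>t\<in>{1..a i}. ?f * gD n lam x emb p a i * (zres (p i t) * ?N t * ?E t))"
    by (simp add: eD_Esum[OF ik] sum_distrib_left)
  also have "\<dots> = - (\<Sum>t\<in>{1..a i}. ?f * Zlt i * (Pexc Kp a i t zvar * ?E t)
       - Fpol j i * Zlt i * (\<Sum>s\<in>{1..a (i-1)}. ?h s t * ?E t))"
    using fg by simp
  also have "\<dots> = G j k i + Fpol j i * Zlt i * (\<Sum>t\<in>{1..a i}. \<Sum>s\<in>{1..a (i-1)}. ?h s t * ?E t)"
    using ik by (simp add: G_def sum_subtractf sum_distrib_left)
  also have "(\<Sum>t\<in>{1..a i}. \<Sum>s\<in>{1..a (i-1)}. ?h s t * ?E t) = (\<Sum>s\<in>{1..a (i-1)}. \<Sum>t\<in>{1..a i}. ?h s t * ?E t)"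
    by (rule sum.swap)
  also have "Fpol j i * Zlt i * \<dots> = H j k i"
    using ik unfolding H_def Eres_def
    by (simp add: K_sum sum_distrib_left mult.assoc flip: fls_const_mult_const)
  finally show ?thesis by simp
qed

text \<open>The partial sum up to \<open>m\<close> is polynomial apart from one unmatched
  \<open>G\<close>. At the lower end \<open>H\<close> vanishes since \<open>a 0 = 0\<close>. At the
  upper end \<open>G\<close> is zero for \<open>i = k\<close>, and for \<open>i = j < k\<close> it
  is polynomial since \<open>f_jj = 1\<close>.\<close>

theorem reg_TD:
  assumes "1 \<le> j" "1 \<le> k" "j \<le> n" "k \<le> n"
  shows "reg (TD n lam x emb p eq eqi a j k)"
proof -
  let ?t = "\<lambda>i. fD p eqi a j i * gD n lam x emb p a i * eD n lam x emb p eq a i k"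
  have *: "reg ((\<Sum>i\<in>{1..m}. ?t i) - G j k m)" if "1 \<le> m" "m \<le> min j k" for m
    using that
  proof (induction m rule: dec_induct)
    case base
    have "H j k 1 = 0" using a_0 by (simp add: H_def)
    then show ?case using term_reg[of 1 j k] assms by simp
  next
    case (step m)
    have "(\<Sum>i\<in>{1..Suc m}. ?t i) - G j k (Suc m) = ((\<Sum>i\<in>{1..m}. ?t i) - G j k m) + (G j k m + H j k (m+1))
        + (?t (Suc m) - (G j k (Suc m) + H j k (Suc m)))" using step by simp
    also have "reg \<dots>"
      using step assms term_reg[of "Suc m" j k] by (intro reg_add[OF reg_add] G_H_reg) auto
    finally show ?case .
  qed
  have "reg (G j k (min j k))"
  proof (cases "min j k < k")
    case True
    then have "min j k = j" by auto
    then show ?thesis using True by (auto simp: G_def fD_def intro!: reg_uminus reg_mult reg_sum)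
  qed (simp add: G_def)
  from reg_add[OF *[of "min j k"] this] show ?thesis
    using assms by (simp add: TD_def)
qed

end

subsection \<open>Degrees\<close>

definition vanish :: "int \<Rightarrow> 'b::zero fls \<Rightarrow> bool" where
  "vanish k f \<longleftrightarrow> (\<forall>j<k. f $$ j = 0)"

lemma vanish_mono: "vanish k f \<Longrightarrow> l \<le> k \<Longrightarrow> vanish l f"
  by (auto simp: vanish_def)

text \<open>Two leading coefficients are tracked because \<open>g_i\<close> may start with
  \<open>z\<close>, and then its constant term is needed too.\<close>

lemma vanish_mult:
  fixes f g :: "'b::ring_1 fls"
  assumes "vanish k f" "vanish l g"
  shows "vanish (k + l) (f * g)" "(f * g) $$ (k + l) = f $$ k * g $$ l"
    "(f * g) $$ (k + l + 1) = f $$ k * g $$ (l + 1) + f $$ (k + 1) * g $$ l"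
proof -
  have *: "(f * g) $$ m = (\<Sum>i=k..m-l. f $$ i * g $$ (m - i))" for m
    using assms by (intro fls_times_nth_low) (auto simp: vanish_def)
  show "vanish (k + l) (f * g)" by (auto simp: vanish_def *)
  show "(f * g) $$ (k + l) = f $$ k * g $$ l" by (simp add: *)
  have "{k..k+1} = {k, k+1}" by auto
  then show "(f * g) $$ (k + l + 1) = f $$ k * g $$ (l + 1) + f $$ (k + 1) * g $$ l"
    by (simp add: * algebra_simps)
qed

lemma vanish_add: "vanish k f \<Longrightarrow> vanish k g \<Longrightarrow> vanish k (f + g :: 'b::ring_1 fls)"
  and vanish_uminus: "vanish k f \<Longrightarrow> vanish k (- f)"
  by (auto simp: vanish_def)

lemma vanish_sum: "(\<And>x. x \<in> A \<Longrightarrow> vanish k (f x :: 'b::ring_1 fls)) \<Longrightarrow> vanish k (sum f A)"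
  by (induction A rule: infinite_finite_induct) (auto intro: vanish_add simp: vanish_def)

text \<open>\<open>monic k c f\<close>: the series \<open>f\<close> is \<open>w^k + c w^(k+1) + \<dots>\<close> with \<open>w = z^(-1)\<close>.\<close>
definition monic :: "int \<Rightarrow> 'b::ring_1 \<Rightarrow> 'b fls \<Rightarrow> bool" where
  "monic k c f \<longleftrightarrow> vanish k f \<and> f $$ k = 1 \<and> f $$ (k + 1) = c"

lemma monic_mult: "monic k c f \<Longrightarrow> monic l d g \<Longrightarrow> monic (k + l) (c + d) (f * g)"
  by (simp add: monic_def vanish_mult add.commute[of d c])

lemma monic_1: "monic 0 0 1"
  by (auto simp: monic_def vanish_def)

lemma monic_prod_list:
  "(\<And>t. t \<in> set ss \<Longrightarrow> monic (k t) (h t) (f t)) \<Longrightarrow>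
    monic (\<Sum>t\<leftarrow>ss. k t) (\<Sum>t\<leftarrow>ss. h t) (prod_list (map f ss))"
  by (induction ss) (auto intro: monic_mult monic_1)

lemma monic_zvar_diff: "monic (-1) (- c) (zvar - K c)"
  by (auto simp: monic_def vanish_def)

lemma monic_zres: "monic 1 c (zres c)"
  by (auto simp: monic_def vanish_def zres_nth)

context difference_operators
begin

lemma monic_Pev: "monic (- int (a i)) (- (\<Sum>r\<in>{1..a i}. p i r)) (Pev Kp a i zvar)"
  using monic_prod_list[OF monic_zvar_diff, of "[1..<Suc (a i)]" "p i"]
  by (simp add: Pev_def sum_negf sum_list_distinct_conv_sum_set atLeastLessThanSuc_atLeastAtMost
      sum_list_triv)

lemma monic_W: "monic (int (a i)) (\<Sum>r\<in>{1..a i}. p i r + 1) (W i)"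
  using monic_prod_list[OF monic_zres, of "[1..<Suc (a i)]" "\<lambda>r. p i r + 1"]
  by (simp add: W_def sum_list_distinct_conv_sum_set atLeastLessThanSuc_atLeastAtMost sum_list_triv)

lemma monic_Zlt:
  "monic (- int (card {s\<in>{1..lam 1}. iS n lam s < i})) (- (\<Sum>s\<in>{s\<in>{1..lam 1}. iS n lam s < i}. emb (x s))) (Zlt i)"
proof (induction i)
  case 0
  then show ?case by (simp add: Zlt_def monic_1)
next
  case (Suc i)
  let ?B = "{s\<in>{1..lam 1}. iS n lam s = i}" and ?A = "\<lambda>i. {s\<in>{1..lam 1}. iS n lam s < i}"
  define ss where "ss = filter (\<lambda>s. iS n lam s = i) [1..<Suc (lam 1)]"
  have ss: "set ss = ?B" "distinct ss" by (auto simp: ss_def)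
  have len: "length ss = card ?B" using distinct_card[OF ss(2)] ss(1) by simp
  have "Zev n lam x (\<lambda>c. K (emb c)) i zvar = prod_list (map (\<lambda>s. zvar - K (emb (x s))) ss)"
    by (simp add: Zev_def ss_def)
  then have Z: "monic (- int (card ?B)) (- (\<Sum>s\<in>?B. emb (x s))) (Zev n lam x (\<lambda>c. K (emb c)) i zvar)"
    using monic_prod_list[OF monic_zvar_diff, of ss "\<lambda>s. emb (x s)"] ss
    by (simp add: sum_negf sum_list_distinct_conv_sum_set len sum_list_triv)
  show ?case
  proof -
    have 1: "?A (Suc i) = ?A i \<union> ?B" "?A i \<inter> ?B = {}" by auto
    have "int (card (?A (Suc i))) = int (card (?A i)) + int (card ?B)"
      unfolding 1(1) by (subst card_Un_disjoint) auto
    moreover have "(\<Sum>s\<in>?A (Suc i). emb (x s)) = (\<Sum>s\<in>?A i. emb (x s)) + (\<Sum>s\<in>?B. emb (x s))"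
      unfolding 1(1) by (rule sum.union_disjoint) auto
    ultimately show ?thesis using monic_mult[OF Suc Z]
      by (simp add: Zlt_Suc)
  qed
qed

lemma monic_gD:
  "monic (int (a (i-1)) - int (a i) - int (card {s\<in>{1..lam 1}. iS n lam s < i}))
    ((\<Sum>r\<in>{1..a (i-1)}. p (i-1) r + 1) - (\<Sum>r\<in>{1..a i}. p i r) - (\<Sum>s\<in>{s\<in>{1..lam 1}. iS n lam s < i}. emb (x s)))
    (gD n lam x emb p a i)"
proof -
  from monic_mult[OF monic_mult[OF monic_Pev monic_W] monic_Zlt, of i "i - 1" i] show ?thesis
    unfolding gD_eq by (simp add: algebra_simps)
qed

lemma vanish_zres_K: "vanish 1 (zres c * K d)" "(zres c * K d) $$ 1 = d"
  by (auto simp: vanish_def zres_nth)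

lemma
  assumes "i < j"
  shows vanish_eD: "vanish 1 (eD n lam x emb p eq a i j)"
    and eD_nth_1: "eD n lam x emb p eq a i j $$ 1 = - (\<Sum>r\<in>rtuples a i j. ecoef n lam x emb p eq a i j r)"
    and vanish_fD: "vanish 1 (fD p eqi a j i)"
    and fD_nth_1: "fD p eqi a j i $$ 1 = (\<Sum>r\<in>rtuples a i j. fcoef p eqi a j i r)"
  using assms unfolding eD_def fD_def
  by (auto intro!: vanish_uminus vanish_sum vanish_zres_K simp: fls_nth_sum zres_nth)

end

section \<open>Combinatorics of the divisor\<close>

lemma sum_image_weighted:
  assumes "finite S"
  shows "(\<Sum>y\<in>x ` S. of_int (\<Sum>s\<in>{s\<in>S. x s = y}. v s) * y) = (\<Sum>s\<in>S. of_int (v s) * (x s :: complex))"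
proof -
  have "(\<Sum>s\<in>S. of_int (v s) * x s) = (\<Sum>y\<in>x ` S. \<Sum>s\<in>{s\<in>S. x s = y}. of_int (v s) * x s)"
    by (rule sum.image_gen[OF assms])
  also have "\<dots> = (\<Sum>y\<in>x ` S. of_int (\<Sum>s\<in>{s\<in>S. x s = y}. v s) * y)"
    by (intro sum.cong) (auto simp: sum_distrib_right)
  finally show ?thesis ..
qed

text \<open>Transposition of the Young diagram: column \<open>s\<close> has height at least
  \<open>k\<close> iff row \<open>k\<close> has length at least \<open>s\<close>. So the product of
  the \<open>Z_k\<close> with \<open>k < i\<close> has degree
  \<open>lam (n - i + 1)\<close>.\<close>

lemma card_iS_less:
  assumes dec: "\<And>i j. 1 \<le> i \<Longrightarrow> i \<le> j \<Longrightarrow> j \<le> n \<Longrightarrow> lam j \<le> lam i" and i: "1 \<le> i" "i \<le> n"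
  shows "card {s\<in>{1..lam 1}. iS n lam s < i} = lam (n - i + 1)"
proof -
  let ?k = "n - i + 1"
  have k: "1 \<le> ?k" "?k \<le> n" using i by auto
  have "iS n lam s < i \<longleftrightarrow> s \<le> lam ?k" if "1 \<le> s" for s
  proof -
    have "?k \<le> colh n lam s \<longleftrightarrow> s \<le> lam ?k"
    proof
      assume "s \<le> lam ?k"
      then have "{1..?k} \<subseteq> {j\<in>{1..n}. s \<le> lam j}" using dec k by (fastforce intro: order_trans)
      from card_mono[OF _ this] show "?k \<le> colh n lam s" by (simp add: colh_def)
    next
      assume c: "?k \<le> colh n lam s"
      show "s \<le> lam ?k"
      proof (rule ccontr)
        assume "\<not> s \<le> lam ?k"
        have "j < ?k" if "j \<in> {1..n}" "s \<le> lam j" for j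
          using dec[of ?k j] k that \<open>\<not> s \<le> lam ?k\<close> by fastforce
        then have "{j\<in>{1..n}. s \<le> lam j} \<subseteq> {1..<?k}" by auto
        from card_mono[OF _ this] c k show False by (simp add: colh_def)
      qed
    qed
    then show ?thesis using i unfolding iS_def by auto
  qed
  moreover have "lam ?k \<le> lam 1" using dec[of 1 ?k] k by auto
  ultimately have "{s\<in>{1..lam 1}. iS n lam s < i} = {1..lam ?k}" by auto
  then show ?thesis by simp
qed

text \<open>A positive tail contains a positive entry; all entries before the tail are then
  nonnegative and the total is positive. Hence \<open>nat\<close> truncates nothing in
  \<open>avec\<close>.\<close>

lemma tail_sum_nonpos:
  fixes b :: "nat \<Rightarrow> int"
  assumes dec: "\<And>i j. 1 \<le> i \<Longrightarrow> i \<le> j \<Longrightarrow> j \<le> n \<Longrightarrow> b j \<le> b i" and total: "(\<Sum>j\<in>{1..n}. b j) = 0"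
    and k: "1 \<le> k" "k \<le> n + 1"
  shows "(\<Sum>j\<in>{k..n}. b j) \<le> 0"
proof (rule ccontr)
  assume neg: "\<not> (\<Sum>j\<in>{k..n}. b j) \<le> 0"
  then obtain j where j: "j \<in> {k..n}" "b j > 0" by (meson not_le sum_nonpos)
  have "b l \<ge> 0" if "l \<in> {1..<k}" for l using dec[of l j] that j k by auto
  then have "(\<Sum>l\<in>{1..<k}. b l) \<ge> 0" by (intro sum_nonneg)
  moreover have "{1..n} = {1..<k} \<union> {k..n}" using k by auto
  then have "(\<Sum>j\<in>{1..n}. b j) = (\<Sum>l\<in>{1..<k}. b l) + (\<Sum>j\<in>{k..n}. b j)"
    by (simp only:) (rule sum.union_disjoint, auto)
  ultimately show False using total neg by auto
qed

text \<open>Together with the degree of the \<open>Z_k\<close>, this makes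
  \<open>mu (n - i + 1)\<close> the order of \<open>g_i\<close> in \<open>1/z\<close>.\<close>

lemma avec_diff:
  assumes lam_dec: "\<And>i j. 1 \<le> i \<Longrightarrow> i \<le> j \<Longrightarrow> j \<le> n \<Longrightarrow> lam j \<le> lam i"
    and mu_dec: "\<And>i j. 1 \<le> i \<Longrightarrow> i \<le> j \<Longrightarrow> j \<le> n \<Longrightarrow> mu j \<le> mu i"
    and size0: "(\<Sum>j\<in>{1..n}. int (lam j)) + (\<Sum>j\<in>{1..n}. mu j) = 0"
    and i: "1 \<le> i" "i \<le> n"
  shows "int (avec n lam mu (i-1)) - int (avec n lam mu i) = int (lam (n-i+1)) + mu (n-i+1)"
proof -
  let ?b = "\<lambda>j. int (lam j) + mu j"
  let ?t = "\<lambda>i. \<Sum>j\<in>{n-i+1..n}. ?b j"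
  have total: "(\<Sum>j\<in>{1..n}. ?b j) = 0" using size0 by (simp add: sum.distrib)
  have "?t i \<le> 0" if "i \<le> n" for i
    by (rule tail_sum_nonpos[OF _ total]) (use that lam_dec mu_dec in \<open>auto intro: add_mono\<close>)
  \<comment> \<open>The prescribed zeros at \<open>i = 0\<close> and \<open>i = n\<close> agree with
    the formula: the tail is empty, respectively the whole sum.\<close>
  then have a: "int (avec n lam mu i) = - ?t i" if "i \<le> n" for i
    using total that unfolding avec_def by (cases "i = 0"; cases "i = n") auto
  have "{n-i+1..n} = insert (n-i+1) {n-(i-1)+1..n}" using i by auto
  then have "?t i = ?b (n-i+1) + ?t (i-1)" using i by simp
  then show ?thesis using i a[of i] a[of "i-1"] by simp
qed

lemma Max_initial_segment:
  assumes "\<And>i j. 1 \<le> i \<Longrightarrow> i \<le> j \<Longrightarrow> j \<le> n \<Longrightarrow> Q j \<Longrightarrow> Q i" "Q 1" "1 \<le> i" "i \<le> n"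
  shows "i \<le> Max {i\<in>{1..n}. Q i} \<longleftrightarrow> Q (i::nat)"
proof
  have fin: "finite {i\<in>{1..n}. Q i}" by simp
  have "1 \<in> {i\<in>{1..n}. Q i}" using assms by auto
  then have "Max {i\<in>{1..n}. Q i} \<in> {i\<in>{1..n}. Q i}" using Max_in[OF fin] by blast
  then show "Q i" if "i \<le> Max {i\<in>{1..n}. Q i}" using assms(1)[of i "Max {i\<in>{1..n}. Q i}"] assms that by auto
qed (use assms in auto)

theorem theorem2p34:
  fixes n :: nat and lam :: "nat \<Rightarrow> nat" and mu :: "nat \<Rightarrow> int" and x :: "nat \<Rightarrow> complex"
    and emb :: "complex \<Rightarrow> 'b::ring_1" and p eq eqi :: "nat \<Rightarrow> nat \<Rightarrow> 'b"
  assumes n2: "n \<ge> 2"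
    and lam_dec: "\<And>i j. 1 \<le> i \<Longrightarrow> i \<le> j \<Longrightarrow> j \<le> n \<Longrightarrow> lam j \<le> lam i"
    and lam_n: "lam n = 0"
    and mu_dec: "\<And>i j. 1 \<le> i \<Longrightarrow> i \<le> j \<Longrightarrow> j \<le> n \<Longrightarrow> mu j \<le> mu i"
    and mu_n: "mu n = -1"
    and size0: "(\<Sum>j\<in>{1..n}. int (lam j)) + (\<Sum>j\<in>{1..n}. mu j) = 0"
    and alg: "A_rel n (avec n lam mu) emb p eq eqi"
  defines "a \<equiv> avec n lam mu"
    and "m \<equiv> Max {i\<in>{1..n}. mu (n - i + 1) = -1}"
    and "m' \<equiv> Max {i\<in>{1..n}. mu (n - i + 1) \<le> 0}"
    and "T \<equiv> TD n lam x emb p eq eqi (avec n lam mu)"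
  shows
    "(\<forall>i\<in>{1..n}. i \<le> m \<longrightarrow>
        T i i = zvar + fls_const ((\<Sum>r\<in>{1..a (i-1)}. p (i-1) r + 1) - (\<Sum>r\<in>{1..a i}. p i r)
                 + emb (\<Sum>y\<in>x ` {1..lam 1}. of_int (lamx n lam x y i) * y)))
   \<and> (\<forall>i\<in>{1..n}. m < i \<and> i \<le> m' \<longrightarrow> T i i = 1)
   \<and> (\<forall>i\<in>{1..n}. m' < i \<longrightarrow> T i i = 0)
   \<and> (\<forall>i\<in>{1..n}. \<forall>j\<in>{1..n}. m < i \<and> i < j \<longrightarrow> T i j = 0 \<and> T j i = 0)
   \<and> (\<forall>i\<in>{1..n}. \<forall>j\<in>{1..n}. i \<le> m \<and> i < j \<longrightarrow>
        T i j = fls_const (- (\<Sum>r\<in>rtuples a i j. ecoef n lam x emb p eq a i j r))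
      \<and> T j i = fls_const (\<Sum>r\<in>rtuples a i j. fcoef p eqi a j i r))
   \<and> (\<forall>\<alpha>\<in>{1..n}. \<forall>\<beta>\<in>{1..n}. \<exists>c.
        T \<alpha> \<beta> = fls_const (if \<alpha> = \<beta> \<and> \<alpha> \<le> m then 1 else 0) * zvar + fls_const c)"
proof -
  interpret difference_operators n a lam x emb p eq eqi
    by unfold_locales (use alg in \<open>auto simp: a_def avec_def\<close>)
  let ?nu = "\<lambda>i. mu (n - i + 1)"
  let ?f = "fD p eqi a" and ?g = "gD n lam x emb p a" and ?e = "eD n lam x emb p eq a"
  let ?ec = "\<lambda>i j. - (\<Sum>r\<in>rtuples a i j. ecoef n lam x emb p eq a i j r)"
    and ?fc = "\<lambda>i j. \<Sum>r\<in>rtuples a i j. fcoef p eqi a j i r"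
  define c where "c i = (\<Sum>r\<in>{1..a (i-1)}. p (i-1) r + 1) - (\<Sum>r\<in>{1..a i}. p i r)
                 + emb (\<Sum>y\<in>x ` {1..lam 1}. of_int (lamx n lam x y i) * y)" for i
  \<comment> \<open>This bound limits the degree of \<open>g_i\<close> in \<open>z\<close> to
    one.\<close>
  have nu_ge: "?nu i \<ge> -1" if "i \<in> {1..n}" for i
    using mu_dec[of "n - i + 1" n] mu_n that by auto
  have m: "i \<le> m \<longleftrightarrow> ?nu i = -1" if "i \<in> {1..n}" for i
    unfolding m_def
  proof (rule Max_initial_segment)
    fix i j assume "1 \<le> i" "i \<le> j" "j \<le> n" "?nu j = -1"
    \<comment> \<open>The index \<open>n - i + 1\<close> reverses the order, so \<open>?nu\<close>
      is weakly increasing and takes its least value on an initial segment.\<close>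
    then show "?nu i = -1" using mu_dec[of "n - j + 1" "n - i + 1"] nu_ge[of i] by auto
  qed (use that mu_n n2 in auto)
  have m': "i \<le> m' \<longleftrightarrow> ?nu i \<le> 0" if "i \<in> {1..n}" for i
    unfolding m'_def
  proof (rule Max_initial_segment)
    fix i j assume "1 \<le> i" "i \<le> j" "j \<le> n" "?nu j \<le> 0"
    moreover from this have "1 \<le> n - j + 1" "n - j + 1 \<le> n - i + 1" "n - i + 1 \<le> n" by linarith+
    ultimately show "?nu i \<le> 0" using mu_dec[of "n - j + 1" "n - i + 1"] by linarith
  qed (use that mu_n n2 in auto)
  have emb0: "emb 0 = 0" using emb_hom(1)[of 0 0] by simp
  have emb_neg: "emb (- w) = - emb w" for w
    using emb_hom(1)[of w "- w"] emb0 by (simp add: eq_neg_iff_add_eq_0 add.commute)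
  have emb_sum: "emb (sum h A) = (\<Sum>s\<in>A. emb (h s))" for h :: "nat \<Rightarrow> complex" and A
    by (induction A rule: infinite_finite_induct) (simp_all add: emb0 emb_hom)
  have g: "monic (?nu i) (c i) (?g i)" if i: "i \<in> {1..n}" for i
  proof -
    let ?S = "{s\<in>{1..lam 1}. iS n lam s < i}"
    have "(\<Sum>y\<in>x ` {1..lam 1}. of_int (lamx n lam x y i) * y)
        = (\<Sum>s\<in>{1..lam 1}. of_int (varpi n (iS n lam s) i) * x s)"
      unfolding lamx_def by (rule sum_image_weighted) simp
    \<comment> \<open>The coefficient of \<open>varpi\<close> is \<open>-1\<close> exactly when
      \<open>iS n lam s < i\<close>, that is, when \<open>x s\<close> is a root counted in
      \<open>Zlt i\<close>.\<close>
    also have "\<dots> = (\<Sum>s\<in>?S. - x s)"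
      by (rule sum.mono_neutral_cong_right) (use i in \<open>auto simp: varpi_def\<close>)
    finally have "emb (\<Sum>y\<in>x ` {1..lam 1}. of_int (lamx n lam x y i) * y) = - (\<Sum>s\<in>?S. emb (x s))"
      by (simp add: emb_sum emb_neg sum_negf)
    moreover have "int (a (i-1)) - int (a i) - int (card ?S) = ?nu i"
      using card_iS_less[of n lam i] avec_diff[of n lam mu i] lam_dec mu_dec size0 i unfolding a_def by simp
    ultimately show ?thesis using monic_gD[of i] by (simp add: c_def)
  qed
  have T_def': "T \<alpha> \<beta> = (\<Sum>i\<in>{1..min \<alpha> \<beta>}. ?f \<alpha> i * ?g i * ?e i \<beta>)" for \<alpha> \<beta>
    unfolding T_def a_def TD_def ..
  have T_nth: "T \<alpha> \<beta> $$ k = (if k \<le> 0 then (?f \<alpha> i * ?g i * ?e i \<beta>) $$ k else 0)"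
    if \<alpha>\<beta>: "\<alpha> \<in> {1..n}" "\<beta> \<in> {1..n}" "i = min \<alpha> \<beta>" for \<alpha> \<beta> i k
  proof (cases "k \<le> 0")
    case False
    then show ?thesis using reg_TD[of \<alpha> \<beta>] that unfolding T_def a_def by (auto simp: reg_def)
  next
    case True
    have "vanish 1 (\<Sum>i\<in>{1..<i}. ?f \<alpha> i * ?g i * ?e i \<beta>)"
    proof (rule vanish_sum)
      fix l assume l: "l \<in> {1..<i}"
      then have l': "l \<in> {1..n}" "l < \<alpha>" "l < \<beta>" using that by auto
      \<comment> \<open>Below the minimum both outer factors are off-diagonal, so the order is at
        least \<open>1 + ?nu l + 1 \<ge> 1\<close>.\<close>
      have "vanish (1 + ?nu l + 1) (?f \<alpha> l * ?g l * ?e l \<beta>)"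
        using l' g[OF l'(1)] by (intro vanish_mult(1) vanish_fD vanish_eD) (auto simp: monic_def)
      then show "vanish 1 (?f \<alpha> l * ?g l * ?e l \<beta>)" by (rule vanish_mono) (use nu_ge[OF l'(1)] in auto)
    qed
    then have "(\<Sum>i\<in>{1..<i}. ?f \<alpha> i * ?g i * ?e i \<beta>) $$ k = 0" using True by (simp add: vanish_def)
    moreover have "{1..i} = insert i {1..<i}" using that by auto
    ultimately show ?thesis using True by (simp add: T_def' flip: \<alpha>\<beta>(3))
  qed
  have diag: "T i i = (if ?nu i = -1 then zvar + K (c i) else if ?nu i = 0 then 1 else 0)" if i: "i \<in> {1..n}" for i
  proof (rule fls_eqI)
    fix k
    have Tk: "T i i $$ k = (if k \<le> 0 then ?g i $$ k else 0)" for k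
      using T_nth[OF i i, of i k] by (simp add: fD_def eD_def)
    have gi: "\<And>j. j < ?nu i \<Longrightarrow> ?g i $$ j = 0" "?g i $$ ?nu i = 1" "?g i $$ (?nu i + 1) = c i"
      using g[OF i] by (auto simp: monic_def vanish_def)
    consider "?nu i = -1" | "?nu i = 0" | "?nu i > 0" using nu_ge[OF i] by linarith
    then show "T i i $$ k = (if ?nu i = -1 then zvar + K (c i) else if ?nu i = 0 then 1 else 0) $$ k"
    proof cases
      case 1
      consider "k < -1" | "k = -1" | "k = 0" | "k > 0" by linarith
      then show ?thesis using 1 gi by cases (auto simp: Tk)
    next
      case 2
      consider "k < 0" | "k = 0" | "k > 0" by linarith
      then show ?thesis using 2 gi by cases (auto simp: Tk)
    next
      case 3
      then show ?thesis using gi(1)[of k] by (auto simp: Tk)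
    qed
  qed
  have off: "T i j = (if ?nu i = -1 then K (?ec i j) else 0)" "T j i = (if ?nu i = -1 then K (?fc i j) else 0)"
    if ij: "i \<in> {1..n}" "j \<in> {1..n}" "i < j" for i j
  proof -
    have gi: "vanish (?nu i) (?g i)" "?g i $$ ?nu i = 1" using g[OF ij(1)] by (auto simp: monic_def)
    note ge = vanish_mult[OF gi(1) vanish_eD[OF ij(3)], unfolded gi(2) eD_nth_1[OF ij(3)] mult_1_left]
    note fg = vanish_mult[OF vanish_fD[OF ij(3)] gi(1), unfolded gi(2) fD_nth_1[OF ij(3)] mult_1_right]
    \<comment> \<open>The order is at least \<open>?nu i + 1 \<ge> 0\<close>, while only
      coefficients with \<open>k \<le> 0\<close> survive. What remains is \<open>k = 0\<close>, and
      only if \<open>?nu i = -1\<close>.\<close>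
    have coeffs: "h = (if ?nu i = -1 then K d else 0)"
      if "vanish (?nu i + 1) u" "u $$ (?nu i + 1) = d" "\<And>k. h $$ k = (if k \<le> 0 then u $$ k else 0)" for h u d
    proof (rule fls_eqI)
      fix k show "h $$ k = (if ?nu i = -1 then K d else 0) $$ k"
        using that nu_ge[OF ij(1)] by (cases "k = 0") (auto simp: vanish_def)
    qed
    show "T i j = (if ?nu i = -1 then K (?ec i j) else 0)"
      by (rule coeffs[OF ge(1,2)]) (use T_nth[of i j i] ij in \<open>auto simp: fD_def\<close>)
    show "T j i = (if ?nu i = -1 then K (?fc i j) else 0)"
      by (rule coeffs[of "?f j i * ?g i"])
        (use fg(1,2) T_nth[of j i i] ij in \<open>auto simp: eD_def add.commute\<close>)
  qed
  have poly: "\<exists>c. T \<alpha> \<beta> = K (if \<alpha> = \<beta> \<and> \<alpha> \<le> m then 1 else 0) * zvar + K c"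
    if \<alpha>\<beta>: "\<alpha> \<in> {1..n}" "\<beta> \<in> {1..n}" for \<alpha> \<beta>
  proof -
    have const: "\<exists>d. (if b then K c else 0) = K d" "\<exists>d. (if b then 1 else 0) = K d" for b and c :: 'b
      by (auto intro: exI[of _ c] exI[of _ 0] exI[of _ 1])
    consider "\<alpha> = \<beta>" "\<alpha> \<le> m" | "\<alpha> = \<beta>" "\<not> \<alpha> \<le> m" | "\<alpha> < \<beta>" | "\<beta> < \<alpha>" by linarith
    then show ?thesis
    proof cases
      case 1
      then show ?thesis using diag[OF \<alpha>\<beta>(1)] m[OF \<alpha>\<beta>(1)] by auto
    next
      case 2
      then show ?thesis using diag[OF \<alpha>\<beta>(1)] m[OF \<alpha>\<beta>(1)] const(2)[of "?nu \<alpha> = 0"] by auto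
    next
      case 3
      then show ?thesis using off(1)[OF \<alpha>\<beta>] const(1)[of "?nu \<alpha> = -1" "?ec \<alpha> \<beta>"] by auto
    next
      case 4
      then show ?thesis using off(2)[OF \<alpha>\<beta>(2,1)] const(1)[of "?nu \<beta> = -1" "?fc \<beta> \<alpha>"] by auto
    qed
  qed
  show ?thesis
  proof (intro conjI ballI impI)
    fix i assume i: "i \<in> {1..n}"
    show "T i i = zvar + K ((\<Sum>r\<in>{1..a (i-1)}. p (i-1) r + 1) - (\<Sum>r\<in>{1..a i}. p i r)
                 + emb (\<Sum>y\<in>x ` {1..lam 1}. of_int (lamx n lam x y i) * y))" if "i \<le> m"
      using diag[OF i] m[OF i] that by (simp add: c_def)
    show "T i i = 1" if "m < i \<and> i \<le> m'" 
      using diag[OF i] m[OF i] m'[OF i] nu_ge[OF i] that by auto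
    show "T i i = 0" if "m' < i" 
      using diag[OF i] m'[OF i] that by auto
    fix j assume j: "j \<in> {1..n}"
    show "T i j = 0" if "m < i \<and> i < j" using off(1)[OF i j] m[OF i] that by auto
    show "T j i = 0" if "m < i \<and> i < j" using off(2)[OF i j] m[OF i] that by auto
    show "T i j = K (?ec i j)" if "i \<le> m \<and> i < j" using off(1)[OF i j] m[OF i] that by auto
    show "T j i = K (?fc i j)" if "i \<le> m \<and> i < j" using off(2)[OF i j] m[OF i] that by auto
    show "\<exists>c. T i j = K (if i = j \<and> i \<le> m then 1 else 0) * zvar + K c" by (rule poly[OF i j])
  qed
qed

end
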